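(* Let $\omega\in\mathbb{R}$, $\lambda\in\mathbb{R}\setminus\{0\}$, and $(\alpha_1,\alpha_2)\in\mathbb{R}^2$. Let $\mathbb{C}^{\uparrow}$ be the carrier space of the representation of $U_\lambda(\mathfrak{iso}_\omega(2))$ induced by the character $1\dashv l=l(\alpha_1,\alpha_2)$ of the commutative subalgebra $\mathcal{L}$ generated by $P_1,P_2$ (so $1\dashv P_1^{n_1}P_2^{n_2}=\alpha_1^{n_1}\alpha_2^{n_2}$). The map sending $f\in\mathbb{C}^\uparrow$ to $\phi(\varphi)=\sum_{m\ge 0} f(J^m)\,\varphi^m/m!$ identifies $\mathbb{C}^{\uparrow}$ with the space of functions $\phi$ of the variable $\varphi$ (formal power series), and under this identification the induced right action of the generators is $$\phi\dashv J=\phi',$$ $$\phi\dashv P_1=\phi\;\frac{2\lambda\alpha_1e^{\lambda\alpha_2}\,\mathrm{C}_\omega(\varphi)+\bigl(\omega\lambda^2\alpha_1^2e^{\lambda\alpha_2}-2\sinh(\lambda\alpha_2)\bigr)\mathrm{S}_\omega(\varphi)}{2\lambda\cosh(\lambda\alpha_2)+\omega\lambda^3\alpha_1^2e^{\lambda\alpha_2}+\bigl(2\lambda\sinh(\lambda\alpha_2)-\omega\lambda^3\alpha_1^2e^{\lambda\alpha_2}\bigr)\mathrm{C}_\omega(\varphi)+2\omega\lambda^2\alpha_1e^{\lambda\alpha_2}\,\mathrm{S}_\omega(\varphi)},$$ $$\phi\dashv P_2=\phi\;\frac1\lambda\ln\Bigl[\cosh(\lambda\alpha_2)+\tfrac1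2\omega\lambda^2\alpha_1^2e^{\lambda\alpha_2}+\bigl(\sinh(\lambda\alpha_2)-\tfrac12\omega\lambda^2\alpha_1^2e^{\lambda\alpha_2}\bigr)\mathrm{C}_\omega(\varphi)+\omega\lambda\alpha_1e^{\lambda\alpha_2}\,\mathrm{S}_\omega(\varphi)\Bigr].$$
   Context: The functions $\mathrm{C}_\omega,\mathrm{S}_\omega$ are $\mathrm{C}_\omega(x)=\frac{e^{\sqrt{-\omega}x}+e^{-\sqrt{-\omega}x}}{2}$, $\mathrm{S}_\omega(x)=\frac{e^{\sqrt{-\omega}x}-e^{-\sqrt{-\omega}x}}{2\sqrt{-\omega}}$ for $\omega\neq0$, and $\mathrm{C}_0(x)=1$, $\mathrm{S}_0(x)=x$. The algebra $H=U_\lambda(\mathfrak{iso}_\omega(2))$ is the unital associative complex algebra generated by $J$ and the commutative subalgebra $\mathcal{L}=\mathbb{C}[P_1,P_2,e^{\pm\lambda P_2}]$ of functions on $\mathbb{R}^2$ (with $P_i(\alpha_1,\alpha_2)=\alpha_i$), subject to $[l,J]=\hat J(l)$ for $l\in\mathcal{L}$, where $\hat J$ is the derivation $$\hat J=-\Bigl[\frac{1-e^{-2\lambda P_2}}{2\lambda}+\frac12\lambda\omega P_1^2\Bigr]\frac{\partial}{\partial P_1}+\omega P_1\frac{\partial}{\partial P_2}.$$ Equivalently $[J,P_1]=\frac{1-e^{-2\lambda P_2}}{2\lambda}+\frac12\lambda\omega P_1^2$, $[J,P_2]=-\omega P_1$, $[P_1,P_2]=0$. As a vector space $H=\bigoplus_{m\ge0}J^m\mathcal{L}$.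 Induced representation: $\mathbb{C}^\uparrow$ is the space of linear maps $f:H\to\mathbb{C}$ with $f(hl)=f(h)\,l(\alpha_1,\alpha_2)$ for all $h\in H$, $l\in\mathcal{L}$, with right $H$-action $(f\dashv h)(h')=f(hh')$. Power series conventions: $\phi'$ is the derivative with respect to $\varphi$; the fraction and the logarithm are expanded as power series in $\varphi$ around $\varphi=0$, where the denominator equals $2\lambda e^{\lambda\alpha_2}\ne0$ and the argument of the logarithm equals $e^{\lambda\alpha_2}>0$. *)

theory Defs
  imports
    "HOL-Complex_Analysis.Complex_Analysis"
    "HOL-Algebra.QuotRing"
    "HOL-Library.Poly_Mapping"
begin

section \<open>The functions C and S\<close>

text \<open>Both are even in the square root, so the choice of branch in \<open>csqrt\<close> is immaterial.\<close>

definition C_fun :: "real \<Rightarrow> complex \<Rightarrow> complex" where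
  "C_fun \<omega> x = (if \<omega> = 0 then 1
     else (exp (csqrt (of_real (- \<omega>)) * x) + exp (- csqrt (of_real (- \<omega>)) * x)) / 2)"

definition S_fun :: "real \<Rightarrow> complex \<Rightarrow> complex" where
  "S_fun \<omega> x = (if \<omega> = 0 then x
     else (exp (csqrt (of_real (- \<omega>)) * x) - exp (- csqrt (of_real (- \<omega>)) * x))
            / (2 * csqrt (of_real (- \<omega>))))"


section \<open>The commutative algebra of functions on the plane\<close>

type_synonym plane_fun = "real \<times> real \<Rightarrow> complex"

definition const_fun :: "complex \<Rightarrow> plane_fun" where
  "const_fun c = (\<lambda>p. c)"

definition P1_fun :: plane_fun where
  "P1_fun = (\<lambda>p. of_real (fst p))"

definition P2_fun :: plane_fun where
  "P2_fun = (\<lambda>p. of_real (snd p))"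

text \<open>The unital subalgebra generated by \<open>P\<^sub>1\<close>, \<open>P\<^sub>2\<close> and \<open>exp (\<plusminus> \<kappa> P\<^sub>2)\<close>, where \<open>\<kappa>\<close> is the
  deformation parameter.\<close>

inductive_set L_alg :: "real \<Rightarrow> plane_fun set" for \<kappa> :: real where
  L_const: "const_fun c \<in> L_alg \<kappa>"
| L_P1: "P1_fun \<in> L_alg \<kappa>"
| L_P2: "P2_fun \<in> L_alg \<kappa>"
| L_exp: "(\<lambda>p. of_real (exp (\<kappa> * snd p))) \<in> L_alg \<kappa>"
| L_exp_neg: "(\<lambda>p. of_real (exp (- (\<kappa> * snd p)))) \<in> L_alg \<kappa>"
| L_add: "l \<in> L_alg \<kappa> \<Longrightarrow> m \<in> L_alg \<kappa> \<Longrightarrow> (\<lambda>p. l p + m p) \<in> L_alg \<kappa>"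
| L_mult: "l \<in> L_alg \<kappa> \<Longrightarrow> m \<in> L_alg \<kappa> \<Longrightarrow> (\<lambda>p. l p * m p) \<in> L_alg \<kappa>"

definition dP1 :: "plane_fun \<Rightarrow> plane_fun" where
  "dP1 l = (\<lambda>p. vector_derivative (\<lambda>t. l (t, snd p)) (at (fst p)))"

definition dP2 :: "plane_fun \<Rightarrow> plane_fun" where
  "dP2 l = (\<lambda>p. vector_derivative (\<lambda>t. l (fst p, t)) (at (snd p)))"

definition J_hat :: "real \<Rightarrow> real \<Rightarrow> plane_fun \<Rightarrow> plane_fun" where
  "J_hat \<kappa> \<omega> l = (\<lambda>p.
     - of_real ((1 - exp (- 2 * \<kappa> * snd p)) / (2 * \<kappa>) + 1 / 2 * \<kappa> * \<omega> * (fst p)\<^sup>2) * dP1 l p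
     + of_real (\<omega> * fst p) * dP2 l p)"


section \<open>The free algebra\<close>

text \<open>Words form a monoid under concatenation; the free algebra on a set of generators is the
  corresponding monoid algebra, i.e. finitely supported functions on words with convolution.\<close>

instantiation list :: (type) monoid_add
begin
definition zero_list :: "'a list" where "zero_list = []"
definition plus_list :: "'a list \<Rightarrow> 'a list \<Rightarrow> 'a list" where "plus_list = (@)"
instance by standard (simp_all add: zero_list_def plus_list_def)
end

definition free_algebra :: "'g set \<Rightarrow> ('g list \<Rightarrow>\<^sub>0 complex) ring" where
  "free_algebra G =
     \<lparr>carrier = {x. Poly_Mapping.keys x \<subseteq> lists G},
      mult = (*), one = 1, zero = 0, add = (+)\<rparr>"

definition free_gen :: "'g \<Rightarrow> ('g list \<Rightarrow>\<^sub>0 complex)" where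
  "free_gen g = Poly_Mapping.single [g] 1"

definition free_scalar :: "complex \<Rightarrow> ('g list \<Rightarrow>\<^sub>0 complex)" where
  "free_scalar c = Poly_Mapping.single [] c"


section \<open>The quantum algebra\<close>

datatype gen = GenJ | GenL plane_fun

definition U_gens :: "real \<Rightarrow> gen set" where
  "U_gens \<kappa> = insert GenJ (GenL ` L_alg \<kappa>)"

text \<open>The first three families say that the algebra of functions is mapped homomorphically, as a
  unital complex algebra; the last one is \<open>[l, J] = J_hat l\<close>.\<close>

definition U_rels :: "real \<Rightarrow> real \<Rightarrow> (gen list \<Rightarrow>\<^sub>0 complex) set" where
  "U_rels \<kappa> \<omega> =
     {free_gen (GenL (\<lambda>p. l p + m p)) - (free_gen (GenL l) + free_gen (GenL m)) | l m.
        l \<in> L_alg \<kappa> \<and> m \<in> L_alg \<kappa>} \<union>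
     {free_gen (GenL (\<lambda>p. l p * m p)) - free_gen (GenL l) * free_gen (GenL m) | l m.
        l \<in> L_alg \<kappa> \<and> m \<in> L_alg \<kappa>} \<union>
     {free_gen (GenL (const_fun c)) - free_scalar c | c. True} \<union>
     {free_gen (GenL l) * free_gen GenJ - free_gen GenJ * free_gen (GenL l)
        - free_gen (GenL (J_hat \<kappa> \<omega> l)) | l. l \<in> L_alg \<kappa>}"

definition U_ideal :: "real \<Rightarrow> real \<Rightarrow> (gen list \<Rightarrow>\<^sub>0 complex) set" where
  "U_ideal \<kappa> \<omega> = Idl\<^bsub>free_algebra (U_gens \<kappa>)\<^esub> (U_rels \<kappa> \<omega>)"

definition U_alg :: "real \<Rightarrow> real \<Rightarrow> (gen list \<Rightarrow>\<^sub>0 complex) set ring" where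
  "U_alg \<kappa> \<omega> = free_algebra (U_gens \<kappa>) Quot U_ideal \<kappa> \<omega>"

definition U_class :: "real \<Rightarrow> real \<Rightarrow> (gen list \<Rightarrow>\<^sub>0 complex) \<Rightarrow> (gen list \<Rightarrow>\<^sub>0 complex) set" where
  "U_class \<kappa> \<omega> x = U_ideal \<kappa> \<omega> +>\<^bsub>free_algebra (U_gens \<kappa>)\<^esub> x"

definition U_J :: "real \<Rightarrow> real \<Rightarrow> (gen list \<Rightarrow>\<^sub>0 complex) set" where
  "U_J \<kappa> \<omega> = U_class \<kappa> \<omega> (free_gen GenJ)"

definition U_L :: "real \<Rightarrow> real \<Rightarrow> plane_fun \<Rightarrow> (gen list \<Rightarrow>\<^sub>0 complex) set" where
  "U_L \<kappa> \<omega> l = U_class \<kappa> \<omega> (free_gen (GenL l))"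

definition U_scale ::
    "real \<Rightarrow> real \<Rightarrow> complex \<Rightarrow> (gen list \<Rightarrow>\<^sub>0 complex) set \<Rightarrow> (gen list \<Rightarrow>\<^sub>0 complex) set" where
  "U_scale \<kappa> \<omega> c h = U_class \<kappa> \<omega> (free_scalar c) \<otimes>\<^bsub>U_alg \<kappa> \<omega>\<^esub> h"


section \<open>The induced representation\<close>

type_synonym U_functional = "(gen list \<Rightarrow>\<^sub>0 complex) set \<Rightarrow> complex"

text \<open>Functionals are extensional, so that equality of functions is equality on the carrier.\<close>

definition U_linear :: "real \<Rightarrow> real \<Rightarrow> U_functional \<Rightarrow> bool" where
  "U_linear \<kappa> \<omega> f \<longleftrightarrow>
     f \<in> extensional (carrier (U_alg \<kappa> \<omega>)) \<and>
     (\<forall>h\<in>carrier (U_alg \<kappa> \<omega>). \<forall>h'\<in>carrier (U_alg \<kappa> \<omega>).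
        f (h \<oplus>\<^bsub>U_alg \<kappa> \<omega>\<^esub> h') = f h + f h') \<and>
     (\<forall>c. \<forall>h\<in>carrier (U_alg \<kappa> \<omega>). f (U_scale \<kappa> \<omega> c h) = c * f h)"

definition C_up :: "real \<Rightarrow> real \<Rightarrow> real \<Rightarrow> real \<Rightarrow> U_functional set" where
  "C_up \<kappa> \<omega> \<alpha>\<^sub>1 \<alpha>\<^sub>2 =
     {f. U_linear \<kappa> \<omega> f \<and>
        (\<forall>h\<in>carrier (U_alg \<kappa> \<omega>). \<forall>l\<in>L_alg \<kappa>.
           f (h \<otimes>\<^bsub>U_alg \<kappa> \<omega>\<^esub> U_L \<kappa> \<omega> l) = f h * l (\<alpha>\<^sub>1, \<alpha>\<^sub>2))}"

definition U_act ::
    "real \<Rightarrow> real \<Rightarrow> U_functional \<Rightarrow> (gen list \<Rightarrow>\<^sub>0 complex) set \<Rightarrow> U_functional" where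
  "U_act \<kappa> \<omega> f h = (\<lambda>h'\<in>carrier (U_alg \<kappa> \<omega>). f (h \<otimes>\<^bsub>U_alg \<kappa> \<omega>\<^esub> h'))"

definition to_fps :: "real \<Rightarrow> real \<Rightarrow> U_functional \<Rightarrow> complex fps" where
  "to_fps \<kappa> \<omega> f = Abs_fps (\<lambda>m. f (U_J \<kappa> \<omega> [^]\<^bsub>U_alg \<kappa> \<omega>\<^esub> m) / fact m)"


section \<open>Well-formedness of the construction\<close>

lemma J_hat_exp_closed: "(\<lambda>p. of_real (exp (- 2 * \<kappa> * snd p))) \<in> L_alg \<kappa>"
proof -
  have "(\<lambda>p. of_real (exp (- 2 * \<kappa> * snd p))) =
        (\<lambda>p. of_real (exp (- (\<kappa> * snd p))) * of_real (exp (- (\<kappa> * snd p))) :: complex)"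
    by (rule ext) (simp flip: of_real_mult exp_add)
  then show ?thesis
    by (rule ssubst) (rule L_mult[OF L_exp_neg L_exp_neg])
qed

lemma L_alg_partials:
  assumes "l \<in> L_alg \<kappa>"
  shows "\<exists>m\<in>L_alg \<kappa>. \<exists>n\<in>L_alg \<kappa>. \<forall>x y.
           ((\<lambda>t. l (t, y)) has_vector_derivative m (x, y)) (at x) \<and>
           ((\<lambda>t. l (x, t)) has_vector_derivative n (x, y)) (at y)"
  using assms
proof induction
  case (L_const c)
  show ?case
    by (rule bexI[of _ "const_fun 0"], rule bexI[of _ "const_fun 0"])
       (auto simp: const_fun_def intro: L_alg.L_const[unfolded const_fun_def])
next
  case L_P1
  show ?case
    by (rule bexI[of _ "const_fun 1"], rule bexI[of _ "const_fun 0"])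
       (auto simp: P1_fun_def const_fun_def intro!: derivative_eq_intros
          L_alg.L_const[unfolded const_fun_def])
next
  case L_P2
  show ?case
    by (rule bexI[of _ "const_fun 0"], rule bexI[of _ "const_fun 1"])
       (auto simp: P2_fun_def const_fun_def intro!: derivative_eq_intros
          L_alg.L_const[unfolded const_fun_def])
next
  case L_exp
  have d: "((\<lambda>t. of_real (exp (\<kappa> * t)) :: complex) has_vector_derivative
              of_real \<kappa> * of_real (exp (\<kappa> * y))) (at y)" for y
    unfolding of_real_mult[symmetric]
    by (rule has_vector_derivative_of_real) (auto intro!: derivative_eq_intros)
  show ?case
    by (rule bexI[of _ "const_fun 0"],
        rule bexI[of _ "\<lambda>p. const_fun (of_real \<kappa>) p * of_real (exp (\<kappa> * snd p))"])
       (use d in \<open>auto simp: const_fun_def intro: L_alg.L_mult L_alg.L_exp L_alg.L_const[unfolded const_fun_def]\<close>)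
next
  case L_exp_neg
  have d: "((\<lambda>t. of_real (exp (- (\<kappa> * t))) :: complex) has_vector_derivative
              of_real (- \<kappa>) * of_real (exp (- (\<kappa> * y)))) (at y)" for y
    unfolding of_real_mult[symmetric]
    by (rule has_vector_derivative_of_real) (auto intro!: derivative_eq_intros)
  show ?case
    by (rule bexI[of _ "const_fun 0"],
        rule bexI[of _ "\<lambda>p. const_fun (of_real (- \<kappa>)) p * of_real (exp (- (\<kappa> * snd p)))"])
       (use d in \<open>auto simp: const_fun_def simp del: of_real_minus mult_minus_left
          intro: L_alg.L_mult L_alg.L_exp_neg L_alg.L_const[unfolded const_fun_def]\<close>)
next
  case (L_add l l')
  then obtain m n m' n' where
    mem: "m \<in> L_alg \<kappa>" "n \<in> L_alg \<kappa>" "m' \<in> L_alg \<kappa>" "n' \<in> L_alg \<kappa>" and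
    d: "\<And>x y. ((\<lambda>t. l (t, y)) has_vector_derivative m (x, y)) (at x)"
       "\<And>x y. ((\<lambda>t. l (x, t)) has_vector_derivative n (x, y)) (at y)"
       "\<And>x y. ((\<lambda>t. l' (t, y)) has_vector_derivative m' (x, y)) (at x)"
       "\<And>x y. ((\<lambda>t. l' (x, t)) has_vector_derivative n' (x, y)) (at y)"
    by metis
  show ?case
    by (rule bexI[of _ "\<lambda>p. m p + m' p"], rule bexI[of _ "\<lambda>p. n p + n' p"])
       (auto intro!: has_vector_derivative_add d L_alg.L_add mem)
next
  case (L_mult l l')
  then obtain m n m' n' where
    mem: "m \<in> L_alg \<kappa>" "n \<in> L_alg \<kappa>" "m' \<in> L_alg \<kappa>" "n' \<in> L_alg \<kappa>" and
    d: "\<And>x y. ((\<lambda>t. l (t, y)) has_vector_derivative m (x, y)) (at x)"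
       "\<And>x y. ((\<lambda>t. l (x, t)) has_vector_derivative n (x, y)) (at y)"
       "\<And>x y. ((\<lambda>t. l' (t, y)) has_vector_derivative m' (x, y)) (at x)"
       "\<And>x y. ((\<lambda>t. l' (x, t)) has_vector_derivative n' (x, y)) (at y)"
    by metis
  show ?case
    by (rule bexI[of _ "\<lambda>p. l p * m' p + m p * l' p"], rule bexI[of _ "\<lambda>p. l p * n' p + n p * l' p"])
       (auto intro!: has_vector_derivative_mult d L_alg.L_add L_alg.L_mult mem L_mult.hyps)
qed

lemma J_hat_closed:
  assumes "l \<in> L_alg \<kappa>"
  shows "J_hat \<kappa> \<omega> l \<in> L_alg \<kappa>"
proof -
  obtain m n where mem: "m \<in> L_alg \<kappa>" "n \<in> L_alg \<kappa>" and
    d: "\<And>x y. ((\<lambda>t. l (t, y)) has_vector_derivative m (x, y)) (at x)"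
       "\<And>x y. ((\<lambda>t. l (x, t)) has_vector_derivative n (x, y)) (at y)"
    using L_alg_partials[OF assms] by metis
  have mn: "dP1 l = m" "dP2 l = n"
    by (auto simp: dP1_def dP2_def fun_eq_iff intro!: vector_derivative_at d)
  have "J_hat \<kappa> \<omega> l =
    (\<lambda>p. (const_fun (- 1 / (2 * of_real \<kappa>)) p
          + (const_fun (1 / (2 * of_real \<kappa>)) p * of_real (exp (- 2 * \<kappa> * snd p))
          + const_fun (- of_real (\<kappa> * \<omega>) / 2) p * (P1_fun p * P1_fun p))) * m p
        + (const_fun (of_real \<omega>) p * P1_fun p) * n p)"
    by (rule ext)
       (simp add: J_hat_def mn const_fun_def P1_fun_def power2_eq_square diff_divide_distrib algebra_simps)
  then show ?thesis
    by (rule ssubst) (intro L_alg.intros J_hat_exp_closed mem)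
qed

lemma free_algebra_simps [simp]:
  "x \<in> carrier (free_algebra G) \<longleftrightarrow> Poly_Mapping.keys x \<subseteq> lists G"
  "x \<otimes>\<^bsub>free_algebra G\<^esub> y = x * y" "\<one>\<^bsub>free_algebra G\<^esub> = 1"
  "x \<oplus>\<^bsub>free_algebra G\<^esub> y = x + y" "\<zero>\<^bsub>free_algebra G\<^esub> = 0"
  by (simp_all add: free_algebra_def)

lemma free_algebra_closed:
  assumes "x \<in> carrier (free_algebra G)" "y \<in> carrier (free_algebra G)"
  shows "x + y \<in> carrier (free_algebra G)" "x * y \<in> carrier (free_algebra G)"
    "- x \<in> carrier (free_algebra G)" "x - y \<in> carrier (free_algebra G)"
proof -
  show "x + y \<in> carrier (free_algebra G)"
    using assms keys_add[of x y] by (simp only: free_algebra_simps) blast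
  show "x * y \<in> carrier (free_algebra G)"
  proof -
    have "a + b \<in> lists G" if "a \<in> lists G" "b \<in> lists G" for a b
      using that by (simp add: plus_list_def)
    then show ?thesis
      using assms keys_mult[of x y] by (simp only: free_algebra_simps) blast
  qed
  show "- x \<in> carrier (free_algebra G)"
    using assms(1) by (simp add: subset_iff in_keys_iff)
  show "x - y \<in> carrier (free_algebra G)"
    using assms keys_diff[of x y] by (simp only: free_algebra_simps) blast
qed

lemma ring_free_algebra: "ring (free_algebra G)"
proof (rule ringI)
  show "abelian_group (free_algebra G)"
  proof (rule abelian_groupI)
    fix x assume "x \<in> carrier (free_algebra G)"
    then have "- x \<in> carrier (free_algebra G)"
      using free_algebra_closed(3) by blast
    then show "\<exists>y\<in>carrier (free_algebra G). y \<oplus>\<^bsub>free_algebra G\<^esub> x = \<zero>\<^bsub>free_algebra G\<^esub>"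
      by (rule bexI[rotated]) simp
  next
    fix x y assume "x \<in> carrier (free_algebra G)" "y \<in> carrier (free_algebra G)"
    then show "x \<oplus>\<^bsub>free_algebra G\<^esub> y \<in> carrier (free_algebra G)"
      using free_algebra_closed(1) by (simp only: free_algebra_simps(4))
  qed (simp_all add: add.assoc add.commute)
next
  show "Group.monoid (free_algebra G)"
  proof (rule monoidI)
    fix x y assume "x \<in> carrier (free_algebra G)" "y \<in> carrier (free_algebra G)"
    then show "x \<otimes>\<^bsub>free_algebra G\<^esub> y \<in> carrier (free_algebra G)"
      using free_algebra_closed(2) by (simp only: free_algebra_simps(2))
  qed (simp_all add: zero_list_def mult.assoc)
qed (simp_all add: distrib_left distrib_right)

lemma U_gens_closed:
  "free_gen GenJ \<in> carrier (free_algebra (U_gens \<kappa>))"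
  "l \<in> L_alg \<kappa> \<Longrightarrow> free_gen (GenL l) \<in> carrier (free_algebra (U_gens \<kappa>))"
  "free_scalar c \<in> carrier (free_algebra (U_gens \<kappa>))"
  by (auto simp: free_algebra_def free_gen_def free_scalar_def U_gens_def)

lemma U_rels_closed: "U_rels \<kappa> \<omega> \<subseteq> carrier (free_algebra (U_gens \<kappa>))"
  unfolding U_rels_def
  by (auto simp del: free_algebra_simps
        intro!: free_algebra_closed U_gens_closed J_hat_closed L_alg.intros)

lemma ideal_U_ideal: "ideal (U_ideal \<kappa> \<omega>) (free_algebra (U_gens \<kappa>))"
  unfolding U_ideal_def
  by (rule ring.genideal_ideal[OF ring_free_algebra U_rels_closed])

lemma ring_U_alg: "ring (U_alg \<kappa> \<omega>)"
  unfolding U_alg_def by (rule ideal.quotient_is_ring[OF ideal_U_ideal])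

lemma U_class_hom: "U_class \<kappa> \<omega> \<in> ring_hom (free_algebra (U_gens \<kappa>)) (U_alg \<kappa> \<omega>)"
  using ideal.rcos_ring_hom[OF ideal_U_ideal, of \<kappa> \<omega>]
  by (simp add: U_alg_def U_class_def[abs_def])

lemma U_class_surj:
  assumes "h \<in> carrier (U_alg \<kappa> \<omega>)"
  obtains x where "x \<in> carrier (free_algebra (U_gens \<kappa>))" "h = U_class \<kappa> \<omega> x"
  using assms by (auto simp: U_alg_def U_class_def FactRing_def A_RCOSETS_defs a_r_coset_def)

lemma free_scalar_central: "free_scalar c * x = x * free_scalar c"
proof (induction x rule: update_induct)
  case const
  show ?case by simp
next
  case (update x g b)
  have "Poly_Mapping.update g b x = x + Poly_Mapping.single g b"
    by (rule poly_mapping_eqI)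
       (use update in \<open>auto simp: lookup_update lookup_add lookup_single when_def in_keys_iff\<close>)
  moreover have "free_scalar c * Poly_Mapping.single g b = Poly_Mapping.single g b * free_scalar c"
    by (simp add: free_scalar_def mult_single plus_list_def mult.commute)
  ultimately show ?case
    using update.IH by (simp add: algebra_simps)
qed

lemma U_scale_mult_right:
  assumes "h \<in> carrier (U_alg \<kappa> \<omega>)" "h' \<in> carrier (U_alg \<kappa> \<omega>)"
  shows "h \<otimes>\<^bsub>U_alg \<kappa> \<omega>\<^esub> U_scale \<kappa> \<omega> c h' = U_scale \<kappa> \<omega> c (h \<otimes>\<^bsub>U_alg \<kappa> \<omega>\<^esub> h')"
proof -
  interpret U: ring "U_alg \<kappa> \<omega>" by (rule ring_U_alg)
  obtain x where x: "x \<in> carrier (free_algebra (U_gens \<kappa>))" "h = U_class \<kappa> \<omega> x"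
    using U_class_surj assms(1) by blast
  have "x \<otimes>\<^bsub>free_algebra (U_gens \<kappa>)\<^esub> free_scalar c =
        free_scalar c \<otimes>\<^bsub>free_algebra (U_gens \<kappa>)\<^esub> x"
    using free_scalar_central[of c x] by simp
  then have "h \<otimes>\<^bsub>U_alg \<kappa> \<omega>\<^esub> U_class \<kappa> \<omega> (free_scalar c) =
        U_class \<kappa> \<omega> (free_scalar c) \<otimes>\<^bsub>U_alg \<kappa> \<omega>\<^esub> h"
    using ring_hom_memE(2)[OF U_class_hom x(1) U_gens_closed(3)]
      ring_hom_memE(2)[OF U_class_hom U_gens_closed(3) x(1)]
    unfolding x(2) by metis
  moreover have c: "U_class \<kappa> \<omega> (free_scalar c) \<in> carrier (U_alg \<kappa> \<omega>)"
    by (rule ring_hom_memE(1)[OF U_class_hom U_gens_closed(3)])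
  ultimately show ?thesis
    unfolding U_scale_def
    using U.m_assoc[OF assms(1) c assms(2)] U.m_assoc[OF c assms] by metis
qed

lemma U_act_closed:
  assumes "f \<in> C_up \<kappa> \<omega> \<alpha>\<^sub>1 \<alpha>\<^sub>2" "h \<in> carrier (U_alg \<kappa> \<omega>)"
  shows "U_act \<kappa> \<omega> f h \<in> C_up \<kappa> \<omega> \<alpha>\<^sub>1 \<alpha>\<^sub>2"
proof -
  interpret U: ring "U_alg \<kappa> \<omega>" by (rule ring_U_alg)
  let ?H = "carrier (U_alg \<kappa> \<omega>)"
  have scale: "U_scale \<kappa> \<omega> c x \<in> ?H" if "x \<in> ?H" for c x
    unfolding U_scale_def
    by (rule U.m_closed[OF ring_hom_memE(1)[OF U_class_hom U_gens_closed(3)] that])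
  have L: "U_L \<kappa> \<omega> l \<in> ?H" if "l \<in> L_alg \<kappa>" for l
    unfolding U_L_def by (rule ring_hom_memE(1)[OF U_class_hom U_gens_closed(2)[OF that]])
  have add: "f (x \<oplus>\<^bsub>U_alg \<kappa> \<omega>\<^esub> y) = f x + f y" if "x \<in> ?H" "y \<in> ?H" for x y
    using assms(1) that unfolding C_up_def U_linear_def by blast
  have scl: "f (U_scale \<kappa> \<omega> c x) = c * f x" if "x \<in> ?H" for c x
    using assms(1) that unfolding C_up_def U_linear_def by blast
  have equi: "f (x \<otimes>\<^bsub>U_alg \<kappa> \<omega>\<^esub> U_L \<kappa> \<omega> l) = f x * l (\<alpha>\<^sub>1, \<alpha>\<^sub>2)"
    if "x \<in> ?H" "l \<in> L_alg \<kappa>" for x l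
    using assms(1) that unfolding C_up_def by blast
  show ?thesis
    unfolding C_up_def U_linear_def mem_Collect_eq
  proof (intro conjI ballI allI)
    show "U_act \<kappa> \<omega> f h \<in> extensional ?H" by (simp add: U_act_def)
  next
    fix x y assume "x \<in> ?H" "y \<in> ?H"
    then show "U_act \<kappa> \<omega> f h (x \<oplus>\<^bsub>U_alg \<kappa> \<omega>\<^esub> y) = U_act \<kappa> \<omega> f h x + U_act \<kappa> \<omega> f h y"
      using assms(2) by (simp add: U_act_def U.r_distr add)
  next
    fix c x assume "x \<in> ?H"
    then show "U_act \<kappa> \<omega> f h (U_scale \<kappa> \<omega> c x) = c * U_act \<kappa> \<omega> f h x"
      using assms(2) by (simp add: U_act_def scale scl U_scale_mult_right)
  next
    fix x l assume "x \<in> ?H" "l \<in> L_alg \<kappa>"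
    then show "U_act \<kappa> \<omega> f h (x \<otimes>\<^bsub>U_alg \<kappa> \<omega>\<^esub> U_L \<kappa> \<omega> l) = U_act \<kappa> \<omega> f h x * l (\<alpha>\<^sub>1, \<alpha>\<^sub>2)"
      using assms(2) equi[of "h \<otimes>\<^bsub>U_alg \<kappa> \<omega>\<^esub> x" l]
      by (simp add: U_act_def L U.m_assoc)
  qed
qed

lemma U_class_eqI:
  assumes "x \<in> carrier (free_algebra (U_gens \<kappa>))" "y \<in> carrier (free_algebra (U_gens \<kappa>))"
    and "x - y \<in> U_rels \<kappa> \<omega>"
  shows "U_class \<kappa> \<omega> x = U_class \<kappa> \<omega> y"
proof -
  interpret F: ring "free_algebra (U_gens \<kappa>)" by (rule ring_free_algebra)
  have neg: "- y \<in> carrier (free_algebra (U_gens \<kappa>))"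
    using free_algebra_closed(3) assms(2) by blast
  have "\<ominus>\<^bsub>free_algebra (U_gens \<kappa>)\<^esub> y = - y"
    by (rule F.minus_equality[OF _ assms(2) neg]) simp
  then have "x \<ominus>\<^bsub>free_algebra (U_gens \<kappa>)\<^esub> y = x - y"
    by (simp add: a_minus_def)
  moreover have "x - y \<in> U_ideal \<kappa> \<omega>"
    unfolding U_ideal_def using F.genideal_self[OF U_rels_closed] assms(3) by blast
  ultimately show ?thesis
    unfolding U_class_def
    using F.quotient_eq_iff_same_a_r_cos[OF ideal_U_ideal assms(1,2)] by simp
qed

lemma U_commutator:
  assumes "l \<in> L_alg \<kappa>"
  shows "U_L \<kappa> \<omega> l \<otimes>\<^bsub>U_alg \<kappa> \<omega>\<^esub> U_J \<kappa> \<omega> =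
         U_J \<kappa> \<omega> \<otimes>\<^bsub>U_alg \<kappa> \<omega>\<^esub> U_L \<kappa> \<omega> l \<oplus>\<^bsub>U_alg \<kappa> \<omega>\<^esub> U_L \<kappa> \<omega> (J_hat \<kappa> \<omega> l)"
proof -
  note hom = ring_hom_memE[OF U_class_hom]
  note gens = U_gens_closed(1) U_gens_closed(2)[OF assms]
    U_gens_closed(2)[OF J_hat_closed[OF assms]]
  have "U_class \<kappa> \<omega> (free_gen (GenL l) * free_gen GenJ) =
        U_class \<kappa> \<omega> (free_gen GenJ * free_gen (GenL l) + free_gen (GenL (J_hat \<kappa> \<omega> l)))"
  proof (rule U_class_eqI)
    show "free_gen (GenL l) * free_gen GenJ
        - (free_gen GenJ * free_gen (GenL l) + free_gen (GenL (J_hat \<kappa> \<omega> l))) \<in> U_rels \<kappa> \<omega>"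
      unfolding U_rels_def diff_diff_eq[symmetric] using assms by blast
  qed (intro free_algebra_closed gens)+
  then have "U_class \<kappa> \<omega> (free_gen (GenL l) \<otimes>\<^bsub>free_algebra (U_gens \<kappa>)\<^esub> free_gen GenJ) =
        U_class \<kappa> \<omega> ((free_gen GenJ \<otimes>\<^bsub>free_algebra (U_gens \<kappa>)\<^esub> free_gen (GenL l))
          \<oplus>\<^bsub>free_algebra (U_gens \<kappa>)\<^esub> free_gen (GenL (J_hat \<kappa> \<omega> l)))"
    by simp
  then show ?thesis
    unfolding U_L_def U_J_def
    by (simp only: hom(2)[OF gens(2,1)] hom(2)[OF gens(1,2)]
        hom(3)[OF ring.ring_simprules(5)[OF ring_free_algebra gens(1,2)] gens(3)])
qed

end

(* Let Psi l be the Taylor series at 0 of l along the integral curve of J_hat through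
   (alpha_1, alpha_2). Psi is an algebra homomorphism intertwining J_hat with d/dphi, so letting
   J act on power series by d/dphi and l by multiplication with Psi l respects the defining
   relations. Taking constant terms of this action inverts to_fps, and a first order recursion on
   coefficients shows that every induced representation acts in this way. The formulas for P_1
   and P_2 then amount to solving x' = -(1 - exp(-2 kappa y)) / (2 kappa) - kappa omega x^2 / 2,
   y' = omega x explicitly: exp(kappa y) and 2 kappa x exp(kappa y) are linear combinations of
   1, C and S. *)

theory Submission
  imports Defs
begin

unbundle no vec_syntax

section \<open>The derivation\<close>

text \<open>Taylor coefficients enter because moving l to the right past J^m with [l, J] = J_hat l
  gives l J^m = sum over k of binom(m, k) J^(m-k) J_hat^k(l). An equivariant functional evaluates
  J_hat^k(l) at the base point, and division by m! leaves a product of two exponential generating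
  functions. The explicit curve comes from a linearisation. With D = exp(\<kappa> y) and N = 2
  \<kappa> x D the system becomes D' = \<omega> N / 2 and N' D = 1 - D^2 + \<omega> N^2 / 4.
  Differentiating the second relation gives N'' = - \<omega> N, so N is a combination of C and S,
  and D one of 1, C and S. Elements of L are functions on the real plane only and cannot be composed
  with a complex flow. The comparison with holomorphic expressions therefore has to take place on a
  real interval.\<close>

lemma J_hat_eqI:
  assumes "\<And>x y. ((\<lambda>t. l (t, y)) has_vector_derivative m (x, y)) (at x)"
    and "\<And>x y. ((\<lambda>t. l (x, t)) has_vector_derivative n (x, y)) (at y)"
  shows "J_hat \<kappa> \<omega> l = (\<lambda>p.
     - of_real ((1 - exp (- 2 * \<kappa> * snd p)) / (2 * \<kappa>) + 1 / 2 * \<kappa> * \<omega> * (fst p)\<^sup>2) * m p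
     + of_real (\<omega> * fst p) * n p)"
proof -
  have "dP1 l = m" "dP2 l = n"
    using assms by (auto simp: dP1_def dP2_def fun_eq_iff intro!: vector_derivative_at)
  then show ?thesis
    by (simp add: J_hat_def)
qed

text \<open>Membership in \<open>L_alg\<close> supplies the partial derivatives; where none exists,
  \<open>vector_derivative\<close> is an unspecified choice.\<close>

lemma J_hat_add:
  assumes "l \<in> L_alg \<kappa>" "l' \<in> L_alg \<kappa>"
  shows "J_hat \<kappa> \<omega> (\<lambda>p. l p + l' p) = (\<lambda>p. J_hat \<kappa> \<omega> l p + J_hat \<kappa> \<omega> l' p)"
proof -
  obtain m n m' n' where
    d: "\<And>x y. ((\<lambda>t. l (t, y)) has_vector_derivative m (x, y)) (at x)"
       "\<And>x y. ((\<lambda>t. l (x, t)) has_vector_derivative n (x, y)) (at y)"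
       "\<And>x y. ((\<lambda>t. l' (t, y)) has_vector_derivative m' (x, y)) (at x)"
       "\<And>x y. ((\<lambda>t. l' (x, t)) has_vector_derivative n' (x, y)) (at y)"
    using L_alg_partials[OF assms(1)] L_alg_partials[OF assms(2)] by metis
  have "J_hat \<kappa> \<omega> (\<lambda>p. l p + l' p) = (\<lambda>p.
     - of_real ((1 - exp (- 2 * \<kappa> * snd p)) / (2 * \<kappa>) + 1 / 2 * \<kappa> * \<omega> * (fst p)\<^sup>2) * (m p + m' p)
     + of_real (\<omega> * fst p) * (n p + n' p))"
    by (rule J_hat_eqI) (intro has_vector_derivative_add d)+
  then show ?thesis
    unfolding J_hat_eqI[OF d(1,2)] J_hat_eqI[OF d(3,4)] by (rule trans) (simp only: distrib_left distrib_right ac_simps)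
qed

lemma J_hat_mult:
  assumes "l \<in> L_alg \<kappa>" "l' \<in> L_alg \<kappa>"
  shows "J_hat \<kappa> \<omega> (\<lambda>p. l p * l' p) = (\<lambda>p. J_hat \<kappa> \<omega> l p * l' p + l p * J_hat \<kappa> \<omega> l' p)"
proof -
  obtain m n m' n' where
    d: "\<And>x y. ((\<lambda>t. l (t, y)) has_vector_derivative m (x, y)) (at x)"
       "\<And>x y. ((\<lambda>t. l (x, t)) has_vector_derivative n (x, y)) (at y)"
       "\<And>x y. ((\<lambda>t. l' (t, y)) has_vector_derivative m' (x, y)) (at x)"
       "\<And>x y. ((\<lambda>t. l' (x, t)) has_vector_derivative n' (x, y)) (at y)"
    using L_alg_partials[OF assms(1)] L_alg_partials[OF assms(2)] by metis
  have "J_hat \<kappa> \<omega> (\<lambda>p. l p * l' p) = (\<lambda>p.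
     - of_real ((1 - exp (- 2 * \<kappa> * snd p)) / (2 * \<kappa>) + 1 / 2 * \<kappa> * \<omega> * (fst p)\<^sup>2)
         * (l p * m' p + m p * l' p)
     + of_real (\<omega> * fst p) * (l p * n' p + n p * l' p))"
    by (rule J_hat_eqI) (intro has_vector_derivative_mult d)+
  then show ?thesis
    unfolding J_hat_eqI[OF d(1,2)] J_hat_eqI[OF d(3,4)] by (rule trans) (simp only: distrib_left distrib_right ac_simps)
qed

lemma J_hat_const: "J_hat \<kappa> \<omega> (const_fun c) = const_fun 0"
  by (subst J_hat_eqI[where m = "const_fun 0" and n = "const_fun 0"]) (auto simp: const_fun_def)

lemma J_hat_P1:
  "J_hat \<kappa> \<omega> P1_fun = (\<lambda>p.
     - of_real ((1 - exp (- 2 * \<kappa> * snd p)) / (2 * \<kappa>) + 1 / 2 * \<kappa> * \<omega> * (fst p)\<^sup>2))"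
  by (subst J_hat_eqI[where m = "const_fun 1" and n = "const_fun 0"])
     (auto simp: const_fun_def P1_fun_def intro!: derivative_eq_intros)

lemma J_hat_P2: "J_hat \<kappa> \<omega> P2_fun = (\<lambda>p. of_real (\<omega> * fst p))"
  by (subst J_hat_eqI[where m = "const_fun 0" and n = "const_fun 1"])
     (auto simp: const_fun_def P2_fun_def intro!: derivative_eq_intros)

text \<open>A free exponent \<open>c\<close> serves both exponential generators, with
  \<open>c\<close> equal to \<kappa> and to - \<kappa>.\<close>

lemma J_hat_exp:
  "J_hat \<kappa> \<omega> (\<lambda>p. of_real (exp (c * snd p))) = (\<lambda>p. of_real (\<omega> * fst p * (c * exp (c * snd p))))"
proof -
  have d: "((\<lambda>t. of_real (exp (c * t)) :: complex) has_vector_derivative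
              of_real (c * exp (c * y))) (at y)" for y
    by (rule has_vector_derivative_of_real) (auto intro!: derivative_eq_intros)
  show ?thesis
    by (subst J_hat_eqI[where m = "const_fun 0" and n = "\<lambda>p. of_real (c * exp (c * snd p))"])
       (use d in \<open>auto simp: const_fun_def\<close>)
qed

lemma J_hat_funpow_closed: "l \<in> L_alg \<kappa> \<Longrightarrow> (J_hat \<kappa> \<omega> ^^ n) l \<in> L_alg \<kappa>"
  by (induction n) (auto intro: J_hat_closed)


section \<open>The Taylor series of a function along the flow of the derivation\<close>

text \<open>The formal Lie series of \<open>J_hat\<close> at \<open>p\<close>. Defined through
  iterates instead of the integral curve, it raises no question of existence or convergence;
  \<open>fps_expansion_along_curve\<close> makes the link with the curve.\<close>

definition flow_series :: "real \<Rightarrow> real \<Rightarrow> real \<times> real \<Rightarrow> plane_fun \<Rightarrow> complex fps" where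
  "flow_series \<kappa> \<omega> p l = Abs_fps (\<lambda>n. (J_hat \<kappa> \<omega> ^^ n) l p / fact n)"

lemma fps_deriv_flow_series:
  "fps_deriv (flow_series \<kappa> \<omega> p l) = flow_series \<kappa> \<omega> p (J_hat \<kappa> \<omega> l)"
proof (rule fps_ext)
  fix n
  have "of_nat (Suc n) * (a / fact (Suc n)) = a / fact n" for a :: complex
    by (simp add: fact_Suc del: of_nat_Suc)
  then show "fps_deriv (flow_series \<kappa> \<omega> p l) $ n = flow_series \<kappa> \<omega> p (J_hat \<kappa> \<omega> l) $ n"
    by (simp add: flow_series_def funpow_swap1 del: of_nat_Suc fact_Suc)
qed

lemma flow_series_nth_0: "flow_series \<kappa> \<omega> p l $ 0 = l p"
  by (simp add: flow_series_def)

text \<open>Formal initial value problems have unique solutions; the index \<open>x\<close> lets the derivative of one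
  unknown be any combination of the other unknowns.\<close>

lemma fps_family_eqI:
  fixes F G :: "'a \<Rightarrow> complex fps"
  assumes "\<And>x. x \<in> A \<Longrightarrow> F x $ 0 = G x $ 0"
    and "\<And>x n. x \<in> A \<Longrightarrow> (\<And>y. y \<in> A \<Longrightarrow> F y $ n = G y $ n) \<Longrightarrow>
           fps_deriv (F x) $ n = fps_deriv (G x) $ n"
    and "x \<in> A"
  shows "F x = G x"
proof -
  have "F x $ n = G x $ n" if "x \<in> A" for n x
    using that
  proof (induction n arbitrary: x)
    case 0
    then show ?case by (rule assms(1))
  next
    case (Suc n)
    then have "fps_deriv (F x) $ n = fps_deriv (G x) $ n"
      by (intro assms(2)) auto
    then show ?case
      by (simp del: of_nat_Suc)
  qed
  then show ?thesis
    using assms(3) by (simp add: fps_eq_iff)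
qed

lemma flow_series_add:
  assumes "l \<in> L_alg \<kappa>" "m \<in> L_alg \<kappa>"
  shows "flow_series \<kappa> \<omega> p (\<lambda>q. l q + m q) = flow_series \<kappa> \<omega> p l + flow_series \<kappa> \<omega> p m"
proof -
  have "(J_hat \<kappa> \<omega> ^^ n) (\<lambda>q. l q + m q) = (\<lambda>q. (J_hat \<kappa> \<omega> ^^ n) l q + (J_hat \<kappa> \<omega> ^^ n) m q)" for n
    by (induction n) (simp_all add: J_hat_add J_hat_funpow_closed assms)
  then show ?thesis
    by (simp add: flow_series_def fps_eq_iff add_divide_distrib)
qed

text \<open>The general Leibniz rule in generating function form. Differentiation replaces one
  factor of the pair by its image under \<open>J_hat\<close>, so the unknowns are indexed by pairs
  and binomial sums are avoided.\<close>

lemma flow_series_mult: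
  assumes "l \<in> L_alg \<kappa>" "m \<in> L_alg \<kappa>"
  shows "flow_series \<kappa> \<omega> p (\<lambda>q. l q * m q) = flow_series \<kappa> \<omega> p l * flow_series \<kappa> \<omega> p m"
proof -
  let ?\<Psi> = "flow_series \<kappa> \<omega> p"
  let ?F = "\<lambda>(l, m). ?\<Psi> (\<lambda>q. l q * m q)" and ?G = "\<lambda>(l, m). ?\<Psi> l * ?\<Psi> m"
  have "?F (l, m) = ?G (l, m)"
  proof (rule fps_family_eqI[of "L_alg \<kappa> \<times> L_alg \<kappa>" ?F ?G])
    fix x assume "x \<in> L_alg \<kappa> \<times> L_alg \<kappa>"
    then show "?F x $ 0 = ?G x $ 0"
      by (auto simp: flow_series_nth_0)
  next
    fix x n
    assume x: "x \<in> L_alg \<kappa> \<times> L_alg \<kappa>"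
      and IH: "\<And>y. y \<in> L_alg \<kappa> \<times> L_alg \<kappa> \<Longrightarrow> ?F y $ n = ?G y $ n"
    obtain l m where lm: "x = (l, m)" "l \<in> L_alg \<kappa>" "m \<in> L_alg \<kappa>"
      using x by blast
    have "fps_deriv (?F x) = ?F (J_hat \<kappa> \<omega> l, m) + ?F (l, J_hat \<kappa> \<omega> m)"
      by (simp add: lm fps_deriv_flow_series J_hat_mult flow_series_add L_alg.L_mult J_hat_closed)
    moreover have "fps_deriv (?G x) = ?G (l, J_hat \<kappa> \<omega> m) + ?G (J_hat \<kappa> \<omega> l, m)"
      by (simp add: lm fps_deriv_flow_series)
    ultimately show "fps_deriv (?F x) $ n = fps_deriv (?G x) $ n"
      using IH[of "(J_hat \<kappa> \<omega> l, m)"] IH[of "(l, J_hat \<kappa> \<omega> m)"] lm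
      by (simp add: J_hat_closed)
  qed (use assms in simp)
  then show ?thesis by simp
qed

lemma flow_series_const: "flow_series \<kappa> \<omega> p (const_fun c) = fps_const c"
proof -
  have z: "(J_hat \<kappa> \<omega> ^^ n) (const_fun 0) = const_fun 0" for n
    by (induction n) (simp_all add: J_hat_const)
  have "(J_hat \<kappa> \<omega> ^^ n) (const_fun c) = (if n = 0 then const_fun c else const_fun 0)" for n
    by (cases n) (simp_all add: funpow_swap1 J_hat_const z)
  then show ?thesis
    by (simp add: flow_series_def fps_eq_iff const_fun_def)
qed


section \<open>Action of the free algebra on formal power series\<close>

text \<open>The free algebra acts for every choice of \<Psi>; the properties of
  \<open>flow_series\<close> enter only when the relations are checked.\<close>

fun gen_act :: "(plane_fun \<Rightarrow> complex fps) \<Rightarrow> complex fps \<Rightarrow> gen \<Rightarrow> complex fps" where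
  "gen_act \<Psi> \<phi> GenJ = fps_deriv \<phi>"
| "gen_act \<Psi> \<phi> (GenL l) = \<phi> * \<Psi> l"

text \<open>This is a right action: the leftmost letter acts first, hence
  \<open>foldl\<close>.\<close>

definition word_act :: "(plane_fun \<Rightarrow> complex fps) \<Rightarrow> complex fps \<Rightarrow> gen list \<Rightarrow> complex fps" where
  "word_act \<Psi> = foldl (gen_act \<Psi>)"

definition free_act ::
    "(plane_fun \<Rightarrow> complex fps) \<Rightarrow> complex fps \<Rightarrow> (gen list \<Rightarrow>\<^sub>0 complex) \<Rightarrow> complex fps" where
  "free_act \<Psi> \<phi> x = (\<Sum>w\<in>Poly_Mapping.keys x. fps_const (Poly_Mapping.lookup x w) * word_act \<Psi> \<phi> w)"

lemma word_act_linear: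
  "word_act \<Psi> (\<phi> + \<psi>) w = word_act \<Psi> \<phi> w + word_act \<Psi> \<psi> w"
  "word_act \<Psi> (fps_const c * \<phi>) w = fps_const c * word_act \<Psi> \<phi> w"
proof -
  have g: "gen_act \<Psi> (\<phi> + \<psi>) a = gen_act \<Psi> \<phi> a + gen_act \<Psi> \<psi> a"
    "gen_act \<Psi> (fps_const c * \<phi>) a = fps_const c * gen_act \<Psi> \<phi> a" for \<phi> \<psi> a
    by (cases a; simp add: algebra_simps)+
  show "word_act \<Psi> (\<phi> + \<psi>) w = word_act \<Psi> \<phi> w + word_act \<Psi> \<psi> w"
    unfolding word_act_def by (induction w arbitrary: \<phi> \<psi>) (simp_all add: g)
  show "word_act \<Psi> (fps_const c * \<phi>) w = fps_const c * word_act \<Psi> \<phi> w"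
    unfolding word_act_def by (induction w arbitrary: \<phi>) (simp_all add: g)
qed

lemma free_act_superset:
  assumes "finite S" "Poly_Mapping.keys x \<subseteq> S"
  shows "free_act \<Psi> \<phi> x = (\<Sum>w\<in>S. fps_const (Poly_Mapping.lookup x w) * word_act \<Psi> \<phi> w)"
  unfolding free_act_def
  by (rule sum.mono_neutral_left) (use assms in \<open>auto simp: in_keys_iff\<close>)

lemma free_act_add: "free_act \<Psi> \<phi> (x + y) = free_act \<Psi> \<phi> x + free_act \<Psi> \<phi> y"
proof -
  let ?S = "Poly_Mapping.keys x \<union> Poly_Mapping.keys y"
  have "free_act \<Psi> \<phi> z = (\<Sum>w\<in>?S. fps_const (Poly_Mapping.lookup z w) * word_act \<Psi> \<phi> w)"
    if "z \<in> {x, y, x + y}" for z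
    by (rule free_act_superset) (use that keys_add[of x y] in auto)
  then show ?thesis
    by (simp add: lookup_add sum.distrib algebra_simps flip: fps_const_add)
qed

lemma free_act_zero [simp]: "free_act \<Psi> \<phi> 0 = 0"
  by (simp add: free_act_def)

lemma free_act_uminus: "free_act \<Psi> \<phi> (- x) = - free_act \<Psi> \<phi> x"
  using free_act_add[of \<Psi> \<phi> x "- x"] by (simp add: minus_unique)

lemma free_act_diff: "free_act \<Psi> \<phi> (x - y) = free_act \<Psi> \<phi> x - free_act \<Psi> \<phi> y"
  using free_act_add[of \<Psi> \<phi> x "- y"] by (simp add: free_act_uminus)

lemma free_act_single:
  "free_act \<Psi> \<phi> (Poly_Mapping.single w c) = fps_const c * word_act \<Psi> \<phi> w"
  by (subst free_act_superset[of "{w}"]) auto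

lemma free_act_add_left: "free_act \<Psi> (\<phi> + \<psi>) x = free_act \<Psi> \<phi> x + free_act \<Psi> \<psi> x"
  by (simp add: free_act_def word_act_linear sum.distrib algebra_simps)

lemma free_act_scale_left: "free_act \<Psi> (fps_const c * \<phi>) x = fps_const c * free_act \<Psi> \<phi> x"
  by (simp add: free_act_def word_act_linear sum_distrib_left mult.left_commute)

lemma free_act_zero_left [simp]: "free_act \<Psi> 0 x = 0"
  using free_act_scale_left[of \<Psi> 0 0 x] by simp

lemma free_algebra_induct [consumes 1, case_names zero add]:
  fixes x :: "'g list \<Rightarrow>\<^sub>0 complex"
  assumes "x \<in> carrier (free_algebra G)"
    and "P 0"
    and "\<And>x w c. x \<in> carrier (free_algebra G) \<Longrightarrow> w \<in> lists G \<Longrightarrow> P x \<Longrightarrow>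
           P (x + Poly_Mapping.single w c)"
  shows "P x"
  using assms(1)
proof (induction x rule: update_induct)
  case const
  show ?case by (rule assms(2))
next
  case (update x w c)
  \<comment> \<open>The word \<open>w\<close> is new and \<open>c\<close> is nonzero, so no key is
    lost and \<open>x\<close> inherits membership in the carrier.\<close>
  have keys: "Poly_Mapping.keys (Poly_Mapping.update w c x) = insert w (Poly_Mapping.keys x)"
    using update.hyps by (auto simp: in_keys_iff lookup_update split: if_splits)
  have "Poly_Mapping.update w c x = x + Poly_Mapping.single w c"
    by (rule poly_mapping_eqI)
       (use update.hyps in \<open>auto simp: lookup_update lookup_add lookup_single when_def in_keys_iff\<close>)
  then show ?case
    using assms(3)[of x w c] update.IH update.prems keys by simp
qed

text \<open>Both sides are additive in \<open>x\<close> and in \<open>y\<close>, so two inductions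
  reduce the claim to single words, where it is \<open>foldl\<close> over a concatenation.\<close>

lemma free_act_mult: "free_act \<Psi> \<phi> (x * y) = free_act \<Psi> (free_act \<Psi> \<phi> x) y"
proof -
  \<comment> \<open>With all letters allowed, the induction rule for the carrier covers arbitrary
    elements.\<close>
  have "x \<in> carrier (free_algebra UNIV)" "y \<in> carrier (free_algebra UNIV)"
    by simp_all
  then show ?thesis
  proof (induction x rule: free_algebra_induct)
    case (add x w c)
    from add.prems
    have "free_act \<Psi> \<phi> (Poly_Mapping.single w c * y) =
          free_act \<Psi> (free_act \<Psi> \<phi> (Poly_Mapping.single w c)) y"
    proof (induction y rule: free_algebra_induct)
      case (add y v d)
      have "word_act \<Psi> \<phi> (w + v) = word_act \<Psi> (word_act \<Psi> \<phi> w) v"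
        by (simp add: word_act_def plus_list_def)
      then show ?case
        using add.IH
        by (simp add: distrib_left free_act_add mult_single free_act_single free_act_scale_left
            word_act_linear algebra_simps flip: fps_const_mult)
    qed simp
    then show ?case
      using add.IH add.prems by (simp add: distrib_right free_act_add free_act_add_left)
  qed simp
qed

lemma free_act_gens [simp]:
  "free_act \<Psi> \<phi> (free_gen GenJ) = fps_deriv \<phi>"
  "free_act \<Psi> \<phi> (free_gen (GenL l)) = \<phi> * \<Psi> l"
  "free_act \<Psi> \<phi> (free_scalar c) = fps_const c * \<phi>"
  "free_act \<Psi> \<phi> 1 = \<phi>"
  by (simp_all add: free_gen_def free_scalar_def free_act_single word_act_def zero_list_def
      flip: single_one)

text \<open>Since \<open>\<Psi>\<close> is an algebra homomorphism intertwining \<open>J_hat\<close> with the derivative, Leibniz' rule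
  gives \<open>[l, J] = J_hat l\<close> on formal power series.\<close>

lemma free_act_rels:
  assumes "x \<in> U_rels \<kappa> \<omega>"
  shows "free_act (flow_series \<kappa> \<omega> p) \<phi> x = 0"
  using assms unfolding U_rels_def
  by (auto simp: free_act_diff free_act_add free_act_mult flow_series_add flow_series_mult
      flow_series_const fps_deriv_flow_series distrib_left mult_ac)

text \<open>The annihilator of a module is a two-sided ideal; containing the relations, it contains
  the ideal that they generate.\<close>

lemma free_act_ideal:
  assumes "x \<in> U_ideal \<kappa> \<omega>"
  shows "free_act (flow_series \<kappa> \<omega> p) \<phi> x = 0"
proof -
  let ?F = "free_algebra (U_gens \<kappa>)"
  \<comment> \<open>Quantifying over all series makes \<open>?I\<close> closed under multiplication
    from the left: in \<open>x * a\<close> the factor \<open>a\<close> acts on the new series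
    produced by \<open>x\<close>.\<close>
  let ?I = "{x \<in> carrier ?F. \<forall>\<phi>. free_act (flow_series \<kappa> \<omega> p) \<phi> x = 0}"
  interpret F: ring ?F by (rule ring_free_algebra)
  have uminus: "\<ominus>\<^bsub>?F\<^esub> y = - y" if "y \<in> carrier ?F" for y
    by (rule F.minus_equality) (use that free_algebra_closed(3)[OF that] in simp_all)
  have "ideal ?I ?F"
  proof (rule idealI[OF ring_free_algebra])
    show "subgroup ?I (add_monoid ?F)"
    proof (rule subgroup.intro)
      fix x assume "x \<in> ?I"
      then show "inv\<^bsub>add_monoid ?F\<^esub> x \<in> ?I"
        using uminus[of x] free_algebra_closed(3)[of x "U_gens \<kappa>"]
        by (simp add: a_inv_def free_act_uminus)
    next
      fix x y assume "x \<in> ?I" "y \<in> ?I"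
      then show "x \<otimes>\<^bsub>add_monoid ?F\<^esub> y \<in> ?I"
        using free_algebra_closed(1)[of x "U_gens \<kappa>" y] by (simp add: free_act_add)
    qed auto
  next
    fix a x assume "a \<in> ?I" "x \<in> carrier ?F"
    then show "x \<otimes>\<^bsub>?F\<^esub> a \<in> ?I" "a \<otimes>\<^bsub>?F\<^esub> x \<in> ?I"
      using free_algebra_closed(2)[of x "U_gens \<kappa>" a] free_algebra_closed(2)[of a "U_gens \<kappa>" x]
      by (simp_all add: free_act_mult)
  qed
  moreover have "U_rels \<kappa> \<omega> \<subseteq> ?I"
    using U_rels_closed[of \<kappa> \<omega>] free_act_rels by blast
  ultimately have "U_ideal \<kappa> \<omega> \<subseteq> ?I"
    unfolding U_ideal_def by (rule F.genideal_minimal)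
  then show ?thesis using assms by blast
qed

lemma free_act_class_cong:
  assumes "x \<in> carrier (free_algebra (U_gens \<kappa>))" "y \<in> carrier (free_algebra (U_gens \<kappa>))"
    and "U_class \<kappa> \<omega> x = U_class \<kappa> \<omega> y"
  shows "free_act (flow_series \<kappa> \<omega> p) \<phi> x = free_act (flow_series \<kappa> \<omega> p) \<phi> y"
proof -
  interpret F: ring "free_algebra (U_gens \<kappa>)" by (rule ring_free_algebra)
  have "\<ominus>\<^bsub>free_algebra (U_gens \<kappa>)\<^esub> y = - y"
    by (rule F.minus_equality) (use assms(2) free_algebra_closed(3)[OF assms(2)] in simp_all)
  then have "x - y \<in> U_ideal \<kappa> \<omega>"
    using F.quotient_eq_iff_same_a_r_cos[OF ideal_U_ideal assms(1,2), of \<omega>] assms(3)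
    by (simp add: U_class_def a_minus_def)
  from free_act_ideal[OF this] show ?thesis
    by (simp add: free_act_diff)
qed

section \<open>The induced representation\<close>

lemma U_class_carrier:
  "x \<in> carrier (free_algebra (U_gens \<kappa>)) \<Longrightarrow> U_class \<kappa> \<omega> x \<in> carrier (U_alg \<kappa> \<omega>)"
  by (rule ring_hom_memE(1)[OF U_class_hom])

lemma U_class_mult:
  assumes "x \<in> carrier (free_algebra (U_gens \<kappa>))" "y \<in> carrier (free_algebra (U_gens \<kappa>))"
  shows "U_class \<kappa> \<omega> (x * y) = U_class \<kappa> \<omega> x \<otimes>\<^bsub>U_alg \<kappa> \<omega>\<^esub> U_class \<kappa> \<omega> y"
  using ring_hom_memE(2)[OF U_class_hom assms] by simp

lemma U_class_add:
  assumes "x \<in> carrier (free_algebra (U_gens \<kappa>))" "y \<in> carrier (free_algebra (U_gens \<kappa>))"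
  shows "U_class \<kappa> \<omega> (x + y) = U_class \<kappa> \<omega> x \<oplus>\<^bsub>U_alg \<kappa> \<omega>\<^esub> U_class \<kappa> \<omega> y"
  using ring_hom_memE(3)[OF U_class_hom assms] by simp

lemma U_class_one: "U_class \<kappa> \<omega> 1 = \<one>\<^bsub>U_alg \<kappa> \<omega>\<^esub>"
  using ring_hom_memE(4)[OF U_class_hom] by simp

lemma U_J_carrier: "U_J \<kappa> \<omega> \<in> carrier (U_alg \<kappa> \<omega>)"
  unfolding U_J_def by (rule U_class_carrier[OF U_gens_closed(1)])

lemma U_L_carrier: "l \<in> L_alg \<kappa> \<Longrightarrow> U_L \<kappa> \<omega> l \<in> carrier (U_alg \<kappa> \<omega>)"
  unfolding U_L_def by (rule U_class_carrier[OF U_gens_closed(2)])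

lemma C_upD:
  assumes "f \<in> C_up \<kappa> \<omega> \<alpha>\<^sub>1 \<alpha>\<^sub>2"
  shows "f \<in> extensional (carrier (U_alg \<kappa> \<omega>))"
    and "h \<in> carrier (U_alg \<kappa> \<omega>) \<Longrightarrow> h' \<in> carrier (U_alg \<kappa> \<omega>) \<Longrightarrow>
           f (h \<oplus>\<^bsub>U_alg \<kappa> \<omega>\<^esub> h') = f h + f h'"
    and "h \<in> carrier (U_alg \<kappa> \<omega>) \<Longrightarrow> f (U_scale \<kappa> \<omega> c h) = c * f h"
    and "h \<in> carrier (U_alg \<kappa> \<omega>) \<Longrightarrow> l \<in> L_alg \<kappa> \<Longrightarrow>
           f (h \<otimes>\<^bsub>U_alg \<kappa> \<omega>\<^esub> U_L \<kappa> \<omega> l) = f h * l (\<alpha>\<^sub>1, \<alpha>\<^sub>2)"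
  using assms unfolding C_up_def U_linear_def by blast+

section \<open>Power series of translated functionals\<close>

lemma to_fps_U_act_nth:
  assumes "h \<in> carrier (U_alg \<kappa> \<omega>)"
  shows "to_fps \<kappa> \<omega> (U_act \<kappa> \<omega> f h) $ n =
         f (h \<otimes>\<^bsub>U_alg \<kappa> \<omega>\<^esub> (U_J \<kappa> \<omega> [^]\<^bsub>U_alg \<kappa> \<omega>\<^esub> n)) / fact n"
proof -
  interpret U: ring "U_alg \<kappa> \<omega>" by (rule ring_U_alg)
  show ?thesis
    using U.nat_pow_closed[OF U_J_carrier] by (simp add: to_fps_def U_act_def)
qed

lemma to_fps_U_act_J:
  "to_fps \<kappa> \<omega> (U_act \<kappa> \<omega> f (U_J \<kappa> \<omega>)) = fps_deriv (to_fps \<kappa> \<omega> f)"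
proof (rule fps_ext)
  fix n
  interpret U: ring "U_alg \<kappa> \<omega>" by (rule ring_U_alg)
  have "of_nat (Suc n) * (a / fact (Suc n)) = a / fact n" for a :: complex
    by (simp add: fact_Suc del: of_nat_Suc)
  \<comment> \<open>The new factor J stands to the left of J^n, whereas \<open>nat_pow_Suc\<close>
    would split it off on the right; hence \<open>nat_pow_Suc2\<close>.\<close>
  then show "to_fps \<kappa> \<omega> (U_act \<kappa> \<omega> f (U_J \<kappa> \<omega>)) $ n = fps_deriv (to_fps \<kappa> \<omega> f) $ n"
    unfolding to_fps_U_act_nth[OF U_J_carrier] U.nat_pow_Suc2[OF U_J_carrier, symmetric]
    by (simp add: to_fps_def del: of_nat_Suc fact_Suc U.nat_pow_Suc)
qed

lemma to_fps_U_act_add: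
  assumes "f \<in> C_up \<kappa> \<omega> \<alpha>\<^sub>1 \<alpha>\<^sub>2" "h \<in> carrier (U_alg \<kappa> \<omega>)" "h' \<in> carrier (U_alg \<kappa> \<omega>)"
  shows "to_fps \<kappa> \<omega> (U_act \<kappa> \<omega> f (h \<oplus>\<^bsub>U_alg \<kappa> \<omega>\<^esub> h')) =
         to_fps \<kappa> \<omega> (U_act \<kappa> \<omega> f h) + to_fps \<kappa> \<omega> (U_act \<kappa> \<omega> f h')"
proof (rule fps_ext)
  fix n
  interpret U: ring "U_alg \<kappa> \<omega>" by (rule ring_U_alg)
  show "to_fps \<kappa> \<omega> (U_act \<kappa> \<omega> f (h \<oplus>\<^bsub>U_alg \<kappa> \<omega>\<^esub> h')) $ n =
         (to_fps \<kappa> \<omega> (U_act \<kappa> \<omega> f h) + to_fps \<kappa> \<omega> (U_act \<kappa> \<omega> f h')) $ n"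
    using assms(2,3) U.nat_pow_closed[OF U_J_carrier]
    by (simp add: to_fps_U_act_nth U.l_distr C_upD(2)[OF assms(1)] add_divide_distrib)
qed

lemma U_act_mult:
  assumes "h \<in> carrier (U_alg \<kappa> \<omega>)" "h' \<in> carrier (U_alg \<kappa> \<omega>)"
  shows "U_act \<kappa> \<omega> f (h \<otimes>\<^bsub>U_alg \<kappa> \<omega>\<^esub> h') = U_act \<kappa> \<omega> (U_act \<kappa> \<omega> f h) h'"
proof -
  interpret U: ring "U_alg \<kappa> \<omega>" by (rule ring_U_alg)
  show ?thesis
    using assms by (auto simp: U_act_def fun_eq_iff restrict_def U.m_assoc)
qed

text \<open>Since J^0 is the unit, constant terms of translates recover every value of the
  functional.\<close>

lemma to_fps_U_act_nth_0:
  assumes "h \<in> carrier (U_alg \<kappa> \<omega>)"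
  shows "to_fps \<kappa> \<omega> (U_act \<kappa> \<omega> f h) $ 0 = f h"
proof -
  interpret U: ring "U_alg \<kappa> \<omega>" by (rule ring_U_alg)
  show ?thesis
    using assms by (simp add: to_fps_U_act_nth)
qed

text \<open>Differentiating the series of f acted on by l means acting by l J = J l + J_hat l. This
  leads to the pairs (f acted on by J, l) and (f, J_hat l), so the coefficient recursion must run
  over all functionals and all l at once.\<close>

lemma to_fps_U_act_L:
  assumes "f \<in> C_up \<kappa> \<omega> \<alpha>\<^sub>1 \<alpha>\<^sub>2" "l \<in> L_alg \<kappa>"
  shows "to_fps \<kappa> \<omega> (U_act \<kappa> \<omega> f (U_L \<kappa> \<omega> l)) = to_fps \<kappa> \<omega> f * flow_series \<kappa> \<omega> (\<alpha>\<^sub>1, \<alpha>\<^sub>2) l"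
proof -
  interpret U: ring "U_alg \<kappa> \<omega>" by (rule ring_U_alg)
  let ?A = "C_up \<kappa> \<omega> \<alpha>\<^sub>1 \<alpha>\<^sub>2 \<times> L_alg \<kappa>" and ?\<Psi> = "flow_series \<kappa> \<omega> (\<alpha>\<^sub>1, \<alpha>\<^sub>2)"
  let ?F = "\<lambda>(f, l). to_fps \<kappa> \<omega> (U_act \<kappa> \<omega> f (U_L \<kappa> \<omega> l))"
  let ?G = "\<lambda>(f, l). to_fps \<kappa> \<omega> f * ?\<Psi> l"
  note carr = U_J_carrier[of \<kappa> \<omega>] U_L_carrier[of _ \<kappa> \<omega>]
  have "?F (f, l) = ?G (f, l)"
  proof (rule fps_family_eqI[of ?A ?F ?G])
    fix x assume "x \<in> ?A"
    then obtain f l where x: "x = (f, l)" "f \<in> C_up \<kappa> \<omega> \<alpha>\<^sub>1 \<alpha>\<^sub>2" "l \<in> L_alg \<kappa>"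
      by blast
    \<comment> \<open>Equivariance at the unit fixes the constant term, the initial value of the
      recursion.\<close>
    have "f (U_L \<kappa> \<omega> l) = f \<one>\<^bsub>U_alg \<kappa> \<omega>\<^esub> * l (\<alpha>\<^sub>1, \<alpha>\<^sub>2)"
      using C_upD(4)[OF x(2) U.one_closed x(3)] x(3) by (simp add: carr)
    then show "?F x $ 0 = ?G x $ 0"
      by (simp add: x to_fps_U_act_nth_0 carr flow_series_nth_0) (simp add: to_fps_def)
  next
    fix x n
    assume "x \<in> ?A" and IH: "\<And>y. y \<in> ?A \<Longrightarrow> ?F y $ n = ?G y $ n"
    then obtain f l where x: "x = (f, l)" "f \<in> C_up \<kappa> \<omega> \<alpha>\<^sub>1 \<alpha>\<^sub>2" "l \<in> L_alg \<kappa>"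
      by blast
    let ?f = "U_act \<kappa> \<omega> f (U_J \<kappa> \<omega>)"
    have "fps_deriv (?F x) = to_fps \<kappa> \<omega> (U_act \<kappa> \<omega> f (U_L \<kappa> \<omega> l \<otimes>\<^bsub>U_alg \<kappa> \<omega>\<^esub> U_J \<kappa> \<omega>))"
      by (simp add: x carr U_act_mult to_fps_U_act_J)
    also have "\<dots> = ?F (?f, l) + ?F (f, J_hat \<kappa> \<omega> l)"
      using x by (simp add: U_commutator to_fps_U_act_add[OF x(2)] U_act_mult carr J_hat_closed)
    finally have F: "fps_deriv (?F x) = ?F (?f, l) + ?F (f, J_hat \<kappa> \<omega> l)" .
    have G: "fps_deriv (?G x) = ?G (f, J_hat \<kappa> \<omega> l) + ?G (?f, l)"
      by (simp add: x fps_deriv_flow_series to_fps_U_act_J)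
    have "(?f, l) \<in> ?A" "(f, J_hat \<kappa> \<omega> l) \<in> ?A"
      using x by (auto intro: U_act_closed carr J_hat_closed)
    from IH[OF this(1)] IH[OF this(2)] show "fps_deriv (?F x) $ n = fps_deriv (?G x) $ n"
      unfolding F G fps_add_nth by simp
  qed (use assms in simp)
  then show ?thesis by simp
qed

text \<open>On both sides the leftmost letter of a word acts first. After it the functional has
  changed but still lies in \<open>C_up\<close> by \<open>U_act_closed\<close>, so the induction on
  words keeps \<open>f\<close> arbitrary.\<close>

lemma to_fps_U_act_class:
  assumes "f \<in> C_up \<kappa> \<omega> \<alpha>\<^sub>1 \<alpha>\<^sub>2" "x \<in> carrier (free_algebra (U_gens \<kappa>))"
  shows "to_fps \<kappa> \<omega> (U_act \<kappa> \<omega> f (U_class \<kappa> \<omega> x)) =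
         free_act (flow_series \<kappa> \<omega> (\<alpha>\<^sub>1, \<alpha>\<^sub>2)) (to_fps \<kappa> \<omega> f) x"
proof -
  interpret U: ring "U_alg \<kappa> \<omega>" by (rule ring_U_alg)
  let ?F = "free_algebra (U_gens \<kappa>)" and ?\<Psi> = "flow_series \<kappa> \<omega> (\<alpha>\<^sub>1, \<alpha>\<^sub>2)"
  have scalar: "to_fps \<kappa> \<omega> (U_act \<kappa> \<omega> f (U_class \<kappa> \<omega> (free_scalar c))) = fps_const c * to_fps \<kappa> \<omega> f"
    if "f \<in> C_up \<kappa> \<omega> \<alpha>\<^sub>1 \<alpha>\<^sub>2" for f c
    using C_upD(3)[OF that] U.nat_pow_closed[OF U_J_carrier]
    unfolding fps_eq_iff to_fps_U_act_nth[OF U_class_carrier[OF U_gens_closed(3)]]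
      U_scale_def[symmetric]
    by (simp add: to_fps_def)
  have word: "to_fps \<kappa> \<omega> (U_act \<kappa> \<omega> f (U_class \<kappa> \<omega> (Poly_Mapping.single w c))) =
        free_act ?\<Psi> (to_fps \<kappa> \<omega> f) (Poly_Mapping.single w c)"
    if "w \<in> lists (U_gens \<kappa>)" "f \<in> C_up \<kappa> \<omega> \<alpha>\<^sub>1 \<alpha>\<^sub>2" for w f c
    using that
  proof (induction w arbitrary: f)
    case Nil
    then show ?case
      using scalar[of f c] by (simp add: free_scalar_def free_act_single word_act_def)
  next
    case (Cons g w)
    have split: "Poly_Mapping.single (g # w) c = free_gen g * Poly_Mapping.single w c"
      by (simp add: free_gen_def mult_single plus_list_def)
    have carr: "free_gen g \<in> carrier ?F" "Poly_Mapping.single w c \<in> carrier ?F"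
      using Cons.hyps by (auto simp: free_gen_def)
    have "to_fps \<kappa> \<omega> (U_act \<kappa> \<omega> f (U_class \<kappa> \<omega> (free_gen g))) =
        free_act ?\<Psi> (to_fps \<kappa> \<omega> f) (free_gen g)"
      using Cons.hyps(1) to_fps_U_act_J[of \<kappa> \<omega> f, unfolded U_J_def]
        to_fps_U_act_L[OF Cons.prems, unfolded U_L_def] by (auto simp: U_gens_def)
    then show ?case
      unfolding split U_class_mult[OF carr] free_act_mult
        U_act_mult[OF U_class_carrier[OF carr(1)] U_class_carrier[OF carr(2)]]
      by (subst Cons.IH[OF U_act_closed[OF Cons.prems U_class_carrier[OF carr(1)]]]) simp
  qed
  show ?thesis
    using assms(2)
  proof (induction x rule: free_algebra_induct)
    case zero
    \<comment> \<open>Zero is treated as the empty word with coefficient 0.\<close>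
    show ?case
      using word[of "[]" f 0] assms(1) by simp
  next
    case (add x w c)
    have "Poly_Mapping.single w c \<in> carrier ?F"
      using add.hyps by simp
    then show ?case
      using add word[OF add.hyps(2) assms(1)]
      by (simp add: U_class_add to_fps_U_act_add[OF assms(1)] U_class_carrier free_act_add
          del: free_algebra_simps(1))
  qed
qed

text \<open>A functional is determined by its series. This yields injectivity, and read backwards it
  dictates the preimage of a given series.\<close>

lemma C_up_class_eq:
  assumes "f \<in> C_up \<kappa> \<omega> \<alpha>\<^sub>1 \<alpha>\<^sub>2" "x \<in> carrier (free_algebra (U_gens \<kappa>))"
  shows "f (U_class \<kappa> \<omega> x) = free_act (flow_series \<kappa> \<omega> (\<alpha>\<^sub>1, \<alpha>\<^sub>2)) (to_fps \<kappa> \<omega> f) x $ 0"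
  using to_fps_U_act_class[OF assms] to_fps_U_act_nth_0[OF U_class_carrier[OF assms(2)]] by metis

lemma to_fps_inj: "inj_on (to_fps \<kappa> \<omega>) (C_up \<kappa> \<omega> \<alpha>\<^sub>1 \<alpha>\<^sub>2)"
proof (rule inj_onI)
  fix f g
  assume fg: "f \<in> C_up \<kappa> \<omega> \<alpha>\<^sub>1 \<alpha>\<^sub>2" "g \<in> C_up \<kappa> \<omega> \<alpha>\<^sub>1 \<alpha>\<^sub>2" "to_fps \<kappa> \<omega> f = to_fps \<kappa> \<omega> g"
  show "f = g"
  proof (rule extensionalityI[OF C_upD(1)[OF fg(1)] C_upD(1)[OF fg(2)]])
    fix h assume "h \<in> carrier (U_alg \<kappa> \<omega>)"
    then obtain x where "x \<in> carrier (free_algebra (U_gens \<kappa>))" "h = U_class \<kappa> \<omega> x"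
      by (rule U_class_surj)
    then show "f h = g h"
      using C_up_class_eq[OF fg(1)] C_up_class_eq[OF fg(2)] fg(3) by simp
  qed
qed

text \<open>The preimage of \<open>\<phi>\<close> sends \<open>h\<close> to the constant term of \<open>\<phi>\<close> acted on by \<open>h\<close>. It is well
  defined because the action on power series respects the relations; no normal form for elements
  of the algebra is required.\<close>

lemma to_fps_surj: "\<exists>f\<in>C_up \<kappa> \<omega> \<alpha>\<^sub>1 \<alpha>\<^sub>2. to_fps \<kappa> \<omega> f = \<phi>"
proof -
  interpret U: ring "U_alg \<kappa> \<omega>" by (rule ring_U_alg)
  interpret F: ring "free_algebra (U_gens \<kappa>)" by (rule ring_free_algebra)
  let ?F = "carrier (free_algebra (U_gens \<kappa>))" and ?\<Psi> = "flow_series \<kappa> \<omega> (\<alpha>\<^sub>1, \<alpha>\<^sub>2)"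
  let ?H = "carrier (U_alg \<kappa> \<omega>)"
  define f where "f = (\<lambda>h\<in>?H. free_act ?\<Psi> \<phi> (SOME x. x \<in> ?F \<and> U_class \<kappa> \<omega> x = h) $ 0)"
  have f: "f (U_class \<kappa> \<omega> x) = free_act ?\<Psi> \<phi> x $ 0" if x: "x \<in> ?F" for x
  proof -
    have "(SOME y. y \<in> ?F \<and> U_class \<kappa> \<omega> y = U_class \<kappa> \<omega> x) \<in> ?F \<and>
        U_class \<kappa> \<omega> (SOME y. y \<in> ?F \<and> U_class \<kappa> \<omega> y = U_class \<kappa> \<omega> x) = U_class \<kappa> \<omega> x"
      by (rule someI[of _ x]) (use x in simp)
    from free_act_class_cong[OF _ x] this show ?thesis
      by (simp add: f_def U_class_carrier[OF x])
  qed
  have mult: "x * y \<in> ?F" if "x \<in> ?F" "y \<in> ?F" for x y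
    using that by (rule free_algebra_closed)
  have "f \<in> C_up \<kappa> \<omega> \<alpha>\<^sub>1 \<alpha>\<^sub>2"
    unfolding C_up_def U_linear_def mem_Collect_eq
  proof (intro conjI ballI allI)
    show "f \<in> extensional ?H" by (simp add: f_def)
  next
    fix h h' assume "h \<in> ?H" "h' \<in> ?H"
    then obtain x y where x: "x \<in> ?F" "h = U_class \<kappa> \<omega> x" and y: "y \<in> ?F" "h' = U_class \<kappa> \<omega> y"
      by (metis U_class_surj)
    have "x + y \<in> ?F"
      using x(1) y(1) by (rule free_algebra_closed)
    then show "f (h \<oplus>\<^bsub>U_alg \<kappa> \<omega>\<^esub> h') = f h + f h'"
      using f x y by (simp add: U_class_add[symmetric] free_act_add del: free_algebra_simps(1))
  next
    fix c h assume "h \<in> ?H"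
    then obtain x where x: "x \<in> ?F" "h = U_class \<kappa> \<omega> x"
      by (metis U_class_surj)
    have "U_scale \<kappa> \<omega> c h = U_class \<kappa> \<omega> (free_scalar c * x)"
      unfolding U_scale_def x(2) by (rule U_class_mult[OF U_gens_closed(3) x(1), symmetric])
    then show "f (U_scale \<kappa> \<omega> c h) = c * f h"
      using f[OF mult[OF U_gens_closed(3) x(1)]] f[OF x(1)] x(2)
      by (simp add: free_act_mult free_act_scale_left)
  next
    fix h l assume "h \<in> ?H" and l: "l \<in> L_alg \<kappa>"
    then obtain x where x: "x \<in> ?F" "h = U_class \<kappa> \<omega> x"
      by (metis U_class_surj)
    have "h \<otimes>\<^bsub>U_alg \<kappa> \<omega>\<^esub> U_L \<kappa> \<omega> l = U_class \<kappa> \<omega> (x * free_gen (GenL l))"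
      unfolding U_L_def x(2) by (rule U_class_mult[OF x(1) U_gens_closed(2)[OF l], symmetric])
    then show "f (h \<otimes>\<^bsub>U_alg \<kappa> \<omega>\<^esub> U_L \<kappa> \<omega> l) = f h * l (\<alpha>\<^sub>1, \<alpha>\<^sub>2)"
      using f[OF mult[OF x(1) U_gens_closed(2)[OF l]]] f[OF x(1)] x(2)
      by (simp add: free_act_mult flow_series_nth_0)
  qed
  moreover have "to_fps \<kappa> \<omega> f = \<phi>"
  proof (rule fps_ext)
    fix n
    \<comment> \<open>\<open>f\<close> is computable only on classes of explicit representatives, so
      J^n is lifted to the free algebra together with its action.\<close>
    have "\<exists>x\<in>?F. U_class \<kappa> \<omega> x = U_J \<kappa> \<omega> [^]\<^bsub>U_alg \<kappa> \<omega>\<^esub> n \<and>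
            (\<forall>\<psi>. free_act ?\<Psi> \<psi> x = (fps_deriv ^^ n) \<psi>)"
    proof (induction n)
      case 0
      show ?case
        using F.one_closed by (intro bexI[of _ 1]) (simp_all add: U_class_one)
    next
      case (Suc n)
      then obtain x where "x \<in> ?F" "U_class \<kappa> \<omega> x = U_J \<kappa> \<omega> [^]\<^bsub>U_alg \<kappa> \<omega>\<^esub> n"
        "\<forall>\<psi>. free_act ?\<Psi> \<psi> x = (fps_deriv ^^ n) \<psi>"
        by blast
      then show ?case
        using mult[of x "free_gen GenJ"] U_gens_closed(1)[of \<kappa>]
        by (intro bexI[of _ "x * free_gen GenJ"])
           (simp_all add: U_class_mult U_J_def free_act_mult del: free_algebra_simps(1))
    qed
    then have "f (U_J \<kappa> \<omega> [^]\<^bsub>U_alg \<kappa> \<omega>\<^esub> n) = (fps_deriv ^^ n) \<phi> $ 0"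
      using f by metis
    also have "(fps_deriv ^^ n) \<phi> $ 0 = fact n * \<phi> $ n"
      by (rule fps_0th_higher_deriv)
    finally show "to_fps \<kappa> \<omega> f $ n = \<phi> $ n"
      by (simp add: to_fps_def)
  qed
  ultimately show ?thesis by blast
qed

section \<open>The flow of the derivation\<close>

text \<open>Along a real integral curve of the vector field \<open>J_hat\<close>, functions in the algebra have Taylor
  coefficients given by the powers of \<open>J_hat\<close>, so the power series can be read off any
  holomorphic extension.\<close>

lemma L_alg_along_curve:
  fixes X Y :: "real \<Rightarrow> real"
  assumes "l \<in> L_alg \<kappa>"
    and X: "(X has_real_derivative
              - ((1 - exp (- 2 * \<kappa> * Y t)) / (2 * \<kappa>) + 1 / 2 * \<kappa> * \<omega> * (X t)\<^sup>2)) (at t)"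
    and Y: "(Y has_real_derivative \<omega> * X t) (at t)"
  shows "((\<lambda>t. l (X t, Y t)) has_vector_derivative J_hat \<kappa> \<omega> l (X t, Y t)) (at t)"
  using assms(1)
proof induction
  case (L_const c)
  show ?case
    unfolding J_hat_const by (simp add: const_fun_def)
next
  case L_P1
  show ?case
    unfolding J_hat_P1
    using has_vector_derivative_of_real[OF X] by (simp only: P1_fun_def fst_conv snd_conv of_real_minus)
next
  case L_P2
  show ?case
    unfolding J_hat_P2 using has_vector_derivative_of_real[OF Y] by (simp add: P2_fun_def)
next
  case L_exp
  have "((\<lambda>t. exp (\<kappa> * Y t)) has_real_derivative \<omega> * X t * (\<kappa> * exp (\<kappa> * Y t))) (at t)"
    by (rule derivative_eq_intros Y refl)+ simp
  from has_vector_derivative_of_real[OF this] show ?case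
    by (simp add: J_hat_exp)
next
  case L_exp_neg
  have "((\<lambda>t. exp (- \<kappa> * Y t)) has_real_derivative \<omega> * X t * (- \<kappa> * exp (- \<kappa> * Y t))) (at t)"
    by (rule derivative_eq_intros Y refl)+ simp
  from has_vector_derivative_of_real[OF this] show ?case
    using J_hat_exp[of \<kappa> \<omega> "- \<kappa>"] by simp
next
  case (L_add l m)
  then show ?case
    unfolding J_hat_add[OF L_add.hyps] by (intro has_vector_derivative_add)
next
  case (L_mult l m)
  then show ?case
    unfolding J_hat_mult[OF L_mult.hyps]
    using has_vector_derivative_mult[OF L_mult.IH] by (simp add: add.commute)
qed

text \<open>Each complex derivative of \<open>F\<close>, restricted to the real axis, is a
  derivative along the curve, where \<open>L_alg_along_curve\<close> computes it. Agreement is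
  proved at every real t in the interval, since the next derivative at 0 depends on a
  neighbourhood.\<close>

lemma fps_expansion_along_curve:
  fixes X Y :: "real \<Rightarrow> real"
  assumes l: "l \<in> L_alg \<kappa>" and "r > 0"
    and F: "F holomorphic_on ball 0 r"
    and eq: "\<And>t. \<bar>t\<bar> < r \<Longrightarrow> F (of_real t) = l (X t, Y t)"
    and X: "\<And>t. \<bar>t\<bar> < r \<Longrightarrow> (X has_real_derivative
              - ((1 - exp (- 2 * \<kappa> * Y t)) / (2 * \<kappa>) + 1 / 2 * \<kappa> * \<omega> * (X t)\<^sup>2)) (at t)"
    and Y: "\<And>t. \<bar>t\<bar> < r \<Longrightarrow> (Y has_real_derivative \<omega> * X t) (at t)"
  shows "fps_expansion F 0 = flow_series \<kappa> \<omega> (X 0, Y 0) l"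
proof -
  have "(deriv ^^ n) F (of_real t) = (J_hat \<kappa> \<omega> ^^ n) l (X t, Y t)" if "\<bar>t\<bar> < r" for n t
    using that
  proof (induction n arbitrary: t)
    case 0
    then show ?case by (simp add: eq)
  next
    case (Suc n)
    let ?G = "(deriv ^^ n) F" and ?m = "(J_hat \<kappa> \<omega> ^^ n) l"
    have "?G holomorphic_on ball 0 r"
      by (rule holomorphic_higher_deriv[OF F]) simp
    then have "(?G has_field_derivative deriv ?G (of_real t)) (at (of_real t))"
      using Suc.prems by (intro holomorphic_derivI[of _ "ball 0 r"]) auto
    then have "((\<lambda>s. ?G (of_real s)) has_vector_derivative deriv ?G (of_real t)) (at t)"
      by (rule has_vector_derivative_real_field)
    moreover have "((\<lambda>s. ?G (of_real s)) has_vector_derivative J_hat \<kappa> \<omega> ?m (X t, Y t)) (at t)"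
    proof (rule has_vector_derivative_transform_within_open)
      show "((\<lambda>t. ?m (X t, Y t)) has_vector_derivative J_hat \<kappa> \<omega> ?m (X t, Y t)) (at t)"
        by (rule L_alg_along_curve[OF J_hat_funpow_closed[OF l] X[OF Suc.prems] Y[OF Suc.prems]])
      show "open (ball 0 r)" "t \<in> ball 0 r"
        using Suc.prems by auto
    qed (auto simp: Suc.IH)
    ultimately show ?case
      using vector_derivative_unique_at by fastforce
  qed
  from this[of 0] show ?thesis
    using \<open>r > 0\<close> by (simp add: fps_expansion_def flow_series_def)
qed

section \<open>Derivatives, Pythagorean identity and real values of C and S\<close>

lemma C_fun_0 [simp]: "C_fun \<omega> 0 = 1" and S_fun_0 [simp]: "S_fun \<omega> 0 = 0"
  by (simp_all add: C_fun_def S_fun_def)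

lemma csqrt_square: "csqrt z * csqrt z = z"
  by (metis power2_csqrt power2_eq_square)

lemma C_fun_has_field_derivative:
  "(C_fun \<omega> has_field_derivative - of_real \<omega> * S_fun \<omega> x) (at x)"
proof (cases "\<omega> = 0")
  case True
  then show ?thesis by (simp add: C_fun_def[abs_def])
next
  case False
  define s where "s = csqrt (of_real (- \<omega>))"
  have s: "s \<noteq> 0" "of_real \<omega> = - (s * s)"
    using False csqrt_square[of "of_real (- \<omega>)"] by (auto simp: s_def)
  have C: "C_fun \<omega> = (\<lambda>x. (exp (s * x) + exp (- s * x)) / 2)"
    and S: "S_fun \<omega> = (\<lambda>x. (exp (s * x) - exp (- s * x)) / (2 * s))"
    using False by (auto simp: C_fun_def S_fun_def s_def)
  show ?thesis
    unfolding C S s(2)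
    by (rule derivative_eq_intros refl)+ (use s(1) in \<open>simp_all add: right_diff_distrib diff_divide_distrib mult.commute\<close>)
qed

lemma S_fun_has_field_derivative:
  "(S_fun \<omega> has_field_derivative C_fun \<omega> x) (at x)"
proof (cases "\<omega> = 0")
  case True
  then show ?thesis by (simp add: C_fun_def[abs_def] S_fun_def[abs_def])
next
  case False
  define s where "s = csqrt (of_real (- \<omega>))"
  have s: "s \<noteq> 0"
    using False by (auto simp: s_def)
  have C: "C_fun \<omega> = (\<lambda>x. (exp (s * x) + exp (- s * x)) / 2)"
    and S: "S_fun \<omega> = (\<lambda>x. (exp (s * x) - exp (- s * x)) / (2 * s))"
    using False by (auto simp: C_fun_def S_fun_def s_def)
  show ?thesis
    unfolding C S
    by (rule derivative_eq_intros refl)+ (use s in \<open>simp_all add: field_simps\<close>)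
qed

lemma C_S_fun_pythagoras: "(C_fun \<omega> x)\<^sup>2 + of_real \<omega> * (S_fun \<omega> x)\<^sup>2 = 1"
proof (cases "\<omega> = 0")
  case True
  then show ?thesis by (simp add: C_fun_def)
next
  case False
  define s where "s = csqrt (of_real (- \<omega>))"
  have s: "s \<noteq> 0" "of_real \<omega> = - (s * s)"
    using False csqrt_square[of "of_real (- \<omega>)"] by (auto simp: s_def)
  define a b where "a = exp (s * x)" and "b = exp (- s * x)"
  have ab: "a * b = 1"
    by (simp add: a_def b_def flip: exp_add)
  have C: "C_fun \<omega> x = (a + b) / 2" and S: "S_fun \<omega> x = (a - b) / (2 * s)"
    using False by (auto simp: C_fun_def S_fun_def s_def a_def b_def)
  have "((a + b) / 2)\<^sup>2 + - (s * s) * ((a - b) / (2 * s))\<^sup>2 = a * b"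
    using s(1) by (simp add: field_simps power2_eq_square)
  then show ?thesis
    unfolding C S s(2) ab .
qed

text \<open>The root of - \<omega> is real or purely imaginary, so conjugation changes it at most by
  a sign, and both functions are even in it.\<close>

lemma C_S_fun_real:
  "C_fun \<omega> (of_real t) \<in> \<real>" "S_fun \<omega> (of_real t) \<in> \<real>"
proof -
  define s where "s = csqrt (of_real (- \<omega>))"
  have "cnj s = s \<or> cnj s = - s"
  proof -
    have "cnj s * cnj s = s * s"
      using csqrt_square[of "of_real (- \<omega>)"] unfolding s_def
      by (metis complex_cnj_complex_of_real complex_cnj_mult)
    then show ?thesis by (simp add: square_eq_iff)
  qed
  then have "cnj (C_fun \<omega> (of_real t)) = C_fun \<omega> (of_real t)"
    "cnj (S_fun \<omega> (of_real t)) = S_fun \<omega> (of_real t)"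
    unfolding C_fun_def S_fun_def s_def[symmetric]
    by (elim disjE; simp add: exp_cnj algebra_simps minus_divide_left flip: minus_divide_right)+
  then show "C_fun \<omega> (of_real t) \<in> \<real>" "S_fun \<omega> (of_real t) \<in> \<real>"
    by (simp_all add: Reals_cnj_iff)
qed

text \<open>The integral curve through \<open>(\<alpha>\<^sub>1, \<alpha>\<^sub>2)\<close> is \<open>(flow_N / (2 * \<kappa> * flow_D), ln flow_D / \<kappa>)\<close>.\<close>

definition flow_N :: "real \<Rightarrow> real \<Rightarrow> real \<Rightarrow> real \<Rightarrow> complex \<Rightarrow> complex" where
  "flow_N \<omega> \<kappa> \<alpha>\<^sub>1 \<alpha>\<^sub>2 \<phi> =
     of_real (2 * \<kappa> * \<alpha>\<^sub>1 * exp (\<kappa> * \<alpha>\<^sub>2)) * C_fun \<omega> \<phi>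
     + of_real (\<omega> * \<kappa>\<^sup>2 * \<alpha>\<^sub>1\<^sup>2 * exp (\<kappa> * \<alpha>\<^sub>2) - 2 * sinh (\<kappa> * \<alpha>\<^sub>2)) * S_fun \<omega> \<phi>"

definition flow_D :: "real \<Rightarrow> real \<Rightarrow> real \<Rightarrow> real \<Rightarrow> complex \<Rightarrow> complex" where
  "flow_D \<omega> \<kappa> \<alpha>\<^sub>1 \<alpha>\<^sub>2 \<phi> =
     of_real (cosh (\<kappa> * \<alpha>\<^sub>2) + 1 / 2 * \<omega> * \<kappa>\<^sup>2 * \<alpha>\<^sub>1\<^sup>2 * exp (\<kappa> * \<alpha>\<^sub>2))
     + of_real (sinh (\<kappa> * \<alpha>\<^sub>2) - 1 / 2 * \<omega> * \<kappa>\<^sup>2 * \<alpha>\<^sub>1\<^sup>2 * exp (\<kappa> * \<alpha>\<^sub>2)) * C_fun \<omega> \<phi>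
     + of_real (\<omega> * \<kappa> * \<alpha>\<^sub>1 * exp (\<kappa> * \<alpha>\<^sub>2)) * S_fun \<omega> \<phi>"

definition flow_N' :: "real \<Rightarrow> real \<Rightarrow> real \<Rightarrow> real \<Rightarrow> complex \<Rightarrow> complex" where
  "flow_N' \<omega> \<kappa> \<alpha>\<^sub>1 \<alpha>\<^sub>2 \<phi> =
     - of_real (\<omega> * (2 * \<kappa> * \<alpha>\<^sub>1 * exp (\<kappa> * \<alpha>\<^sub>2))) * S_fun \<omega> \<phi>
     + of_real (\<omega> * \<kappa>\<^sup>2 * \<alpha>\<^sub>1\<^sup>2 * exp (\<kappa> * \<alpha>\<^sub>2) - 2 * sinh (\<kappa> * \<alpha>\<^sub>2)) * C_fun \<omega> \<phi>"

lemma flow_N_has_field_derivative: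
  "(flow_N \<omega> \<kappa> \<alpha>\<^sub>1 \<alpha>\<^sub>2 has_field_derivative flow_N' \<omega> \<kappa> \<alpha>\<^sub>1 \<alpha>\<^sub>2 x) (at x)"
  unfolding flow_N_def[abs_def] flow_N'_def
  by (rule derivative_eq_intros refl C_fun_has_field_derivative S_fun_has_field_derivative)+ simp

text \<open>This is y' = \<omega> x multiplied by \<kappa> exp(\<kappa> y).\<close>

lemma flow_D_has_field_derivative:
  "(flow_D \<omega> \<kappa> \<alpha>\<^sub>1 \<alpha>\<^sub>2 has_field_derivative of_real \<omega> * flow_N \<omega> \<kappa> \<alpha>\<^sub>1 \<alpha>\<^sub>2 x / 2) (at x)"
  unfolding flow_N_def flow_D_def[abs_def]
  by (rule derivative_eq_intros refl C_fun_has_field_derivative S_fun_has_field_derivative)+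
     (simp add: field_simps)

text \<open>This is the equation for x' with x = N / (2 \<kappa> D), cleared of denominators by the
  factor 2 \<kappa> D^2, where D' = \<omega> N / 2 has been inserted.\<close>

lemma flow_invariant:
  "flow_N' \<omega> \<kappa> \<alpha>\<^sub>1 \<alpha>\<^sub>2 x * flow_D \<omega> \<kappa> \<alpha>\<^sub>1 \<alpha>\<^sub>2 x - of_real \<omega> * (flow_N \<omega> \<kappa> \<alpha>\<^sub>1 \<alpha>\<^sub>2 x)\<^sup>2 / 4
     + (flow_D \<omega> \<kappa> \<alpha>\<^sub>1 \<alpha>\<^sub>2 x)\<^sup>2 = 1"
proof -
  define c s e w C S where
    "c = complex_of_real (cosh (\<kappa> * \<alpha>\<^sub>2))" "s = complex_of_real (sinh (\<kappa> * \<alpha>\<^sub>2))"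
    "e = complex_of_real (exp (\<kappa> * \<alpha>\<^sub>2))" "w = complex_of_real \<omega>"
    "C = C_fun \<omega> x" "S = S_fun \<omega> x"
  note defs = this
  define v q where "v = of_real (\<kappa> * \<alpha>\<^sub>1) * e" "q = w * (of_real (\<kappa> * \<alpha>\<^sub>1))\<^sup>2 * e / 2"
  note defs' = this
  have "c\<^sup>2 - s\<^sup>2 = of_real ((cosh (\<kappa> * \<alpha>\<^sub>2))\<^sup>2 - (sinh (\<kappa> * \<alpha>\<^sub>2))\<^sup>2)"
    by (simp add: defs)
  then have cs: "c\<^sup>2 - s\<^sup>2 = 1"
    by (simp add: hyperbolic_pythagoras)
  have e: "c + s = e"
    unfolding defs by (simp add: cosh_plus_sinh flip: of_real_add)
  have CS: "C\<^sup>2 + w * S\<^sup>2 = 1"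
    by (simp add: defs C_S_fun_pythagoras)
  have N: "flow_N \<omega> \<kappa> \<alpha>\<^sub>1 \<alpha>\<^sub>2 x = 2 * (v * C - (s - q) * S)"
    by (simp add: flow_N_def defs defs' algebra_simps power_mult_distrib)
  have N': "flow_N' \<omega> \<kappa> \<alpha>\<^sub>1 \<alpha>\<^sub>2 x = - 2 * (w * v * S + (s - q) * C)"
    by (simp add: flow_N'_def defs defs' algebra_simps power_mult_distrib)
  have D: "flow_D \<omega> \<kappa> \<alpha>\<^sub>1 \<alpha>\<^sub>2 x = c + q + (s - q) * C + w * v * S"
    by (simp add: flow_D_def defs defs' algebra_simps power_mult_distrib)
  \<comment> \<open>With A = (s - q) C + w v S one has N' = - 2 A and D = c + q + A, so N' D + D^2 =
    (c + q)^2 - A^2. The cross terms of A^2 and w N^2 / 4 cancel, leaving a multiple of C^2 + w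
    S^2.\<close>
  have "flow_N' \<omega> \<kappa> \<alpha>\<^sub>1 \<alpha>\<^sub>2 x * flow_D \<omega> \<kappa> \<alpha>\<^sub>1 \<alpha>\<^sub>2 x - of_real \<omega> * (flow_N \<omega> \<kappa> \<alpha>\<^sub>1 \<alpha>\<^sub>2 x)\<^sup>2 / 4
      + (flow_D \<omega> \<kappa> \<alpha>\<^sub>1 \<alpha>\<^sub>2 x)\<^sup>2 = (c + q)\<^sup>2 - ((s - q)\<^sup>2 + w * v\<^sup>2) * (C\<^sup>2 + w * S\<^sup>2)"
    unfolding N N' D defs(4)[symmetric] by (simp add: power2_eq_square field_simps)
  also have "\<dots> = (c\<^sup>2 - s\<^sup>2) + 2 * q * (c + s) - w * v\<^sup>2"
    unfolding CS by (simp add: power2_eq_square algebra_simps)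
  \<comment> \<open>The terms 2 q e and w v^2 cancel: both equal \<omega> times the square of
    v.\<close>
  also have "\<dots> = 1"
    unfolding cs e by (simp add: defs' power2_eq_square)
  finally show ?thesis .
qed

lemma flow_D_0: "flow_D \<omega> \<kappa> \<alpha>\<^sub>1 \<alpha>\<^sub>2 0 = of_real (exp (\<kappa> * \<alpha>\<^sub>2))"
proof -
  have "flow_D \<omega> \<kappa> \<alpha>\<^sub>1 \<alpha>\<^sub>2 0 = of_real (cosh (\<kappa> * \<alpha>\<^sub>2) + sinh (\<kappa> * \<alpha>\<^sub>2))"
    by (simp add: flow_D_def)
  then show ?thesis
    by (simp only: cosh_plus_sinh)
qed

lemma flow_real:
  "flow_N \<omega> \<kappa> \<alpha>\<^sub>1 \<alpha>\<^sub>2 (of_real t) \<in> \<real>" "flow_D \<omega> \<kappa> \<alpha>\<^sub>1 \<alpha>\<^sub>2 (of_real t) \<in> \<real>"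
  "flow_N' \<omega> \<kappa> \<alpha>\<^sub>1 \<alpha>\<^sub>2 (of_real t) \<in> \<real>"
  unfolding flow_N_def flow_D_def flow_N'_def
  by (intro Reals_add Reals_mult Reals_minus Reals_of_real C_S_fun_real)+

lemma flow_series_P1_P2:
  assumes "\<kappa> \<noteq> 0"
  shows "flow_series \<kappa> \<omega> (\<alpha>\<^sub>1, \<alpha>\<^sub>2) P1_fun =
           fps_expansion (\<lambda>\<phi>. flow_N \<omega> \<kappa> \<alpha>\<^sub>1 \<alpha>\<^sub>2 \<phi> / (2 * of_real \<kappa> * flow_D \<omega> \<kappa> \<alpha>\<^sub>1 \<alpha>\<^sub>2 \<phi>)) 0"
    and "flow_series \<kappa> \<omega> (\<alpha>\<^sub>1, \<alpha>\<^sub>2) P2_fun =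
           fps_expansion (\<lambda>\<phi>. 1 / of_real \<kappa> * Ln (flow_D \<omega> \<kappa> \<alpha>\<^sub>1 \<alpha>\<^sub>2 \<phi>)) 0"
proof -
  let ?N = "flow_N \<omega> \<kappa> \<alpha>\<^sub>1 \<alpha>\<^sub>2" and ?D = "flow_D \<omega> \<kappa> \<alpha>\<^sub>1 \<alpha>\<^sub>2" and ?N' = "flow_N' \<omega> \<kappa> \<alpha>\<^sub>1 \<alpha>\<^sub>2"
  define N D N' where "N = (\<lambda>t. Re (?N (of_real t)))" "D = (\<lambda>t. Re (?D (of_real t)))"
    "N' = (\<lambda>t. Re (?N' (of_real t)))"
  note ND_def = this
  have of_real: "?N (of_real t) = of_real (N t)" "?D (of_real t) = of_real (D t)"
    "?N' (of_real t) = of_real (N' t)" for t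
    using flow_real[of \<omega> \<kappa> \<alpha>\<^sub>1 \<alpha>\<^sub>2 t] by (simp_all add: ND_def)
  have hol: "?N holomorphic_on A" "?D holomorphic_on A" for A
    unfolding holomorphic_on_def field_differentiable_def
    using has_field_derivative_at_within[OF flow_N_has_field_derivative]
      has_field_derivative_at_within[OF flow_D_has_field_derivative] by blast+
  \<comment> \<open>A disc on which D has positive real part serves twice: the quotient has no pole
    there and \<open>Ln\<close> stays off its branch cut. It exists because D(0) = exp(\<kappa>
    \<alpha>_2) > 0.\<close>
  have "open {z. 0 < Re (?D z)}"
    by (intro open_Collect_less continuous_intros holomorphic_on_imp_continuous_on hol)
  moreover have "0 \<in> {z. 0 < Re (?D z)}"
    by (simp add: flow_D_0)
  ultimately obtain r where "r > 0" "ball 0 r \<subseteq> {z. 0 < Re (?D z)}"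
    by (rule openE)
  then have r: "r > 0" "\<And>z. cmod z < r \<Longrightarrow> Re (?D z) > 0"
    by auto
  have D_pos: "D t > 0" if "\<bar>t\<bar> < r" for t
    using r(2)[of "of_real t"] that by (simp add: ND_def)
  have N_deriv: "(N has_real_derivative N' t) (at t)" for t
    unfolding ND_def
    by (rule has_field_derivative_Re[OF has_vector_derivative_real_field[OF flow_N_has_field_derivative]])
  have D_deriv: "(D has_real_derivative \<omega> * N t / 2) (at t)" for t
    using has_field_derivative_Re[OF has_vector_derivative_real_field[OF
          flow_D_has_field_derivative[of \<omega> \<kappa> \<alpha>\<^sub>1 \<alpha>\<^sub>2 "of_real t"]]]
    by (simp add: ND_def)
  have inv: "N' t * D t - \<omega> * (N t)\<^sup>2 / 4 + (D t)\<^sup>2 = 1" for t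
  proof -
    have "complex_of_real (N' t * D t - \<omega> * (N t)\<^sup>2 / 4 + (D t)\<^sup>2) = of_real 1"
      using flow_invariant[of \<omega> \<kappa> \<alpha>\<^sub>1 \<alpha>\<^sub>2 "of_real t"] by (simp add: of_real)
    then show ?thesis by (simp only: of_real_eq_iff)
  qed
  define X Y where "X = (\<lambda>t. N t / (2 * \<kappa> * D t))" "Y = (\<lambda>t. 1 / \<kappa> * ln (D t))"
  note XY_def = this
  have Y: "(Y has_real_derivative \<omega> * X t) (at t)" if "\<bar>t\<bar> < r" for t
    unfolding XY_def
    by (rule derivative_eq_intros refl D_deriv D_pos[OF that])+
       (use assms D_pos[OF that] in \<open>simp add: field_simps\<close>)
  have X: "(X has_real_derivative
              - ((1 - exp (- 2 * \<kappa> * Y t)) / (2 * \<kappa>) + 1 / 2 * \<kappa> * \<omega> * (X t)\<^sup>2)) (at t)"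
    if "\<bar>t\<bar> < r" for t
  proof -
    note pos = D_pos[OF that]
    have "exp (- 2 * \<kappa> * Y t) = exp (- (ln (D t) + ln (D t)))"
      using assms by (simp add: XY_def)
    also have "\<dots> = 1 / (D t)\<^sup>2"
      using pos by (simp only: exp_minus exp_add exp_ln) (simp add: power2_eq_square field_simps)
    finally have e: "exp (- 2 * \<kappa> * Y t) = 1 / (D t)\<^sup>2" .
    \<comment> \<open>Solving the invariant for N' turns the quotient rule for X into the required
      right-hand side.\<close>
    have N': "N' t = (1 + \<omega> * (N t)\<^sup>2 / 4 - (D t)\<^sup>2) / D t"
      using inv[of t] pos by (simp add: field_simps)
    have "(X has_real_derivative
            (N' t * (2 * \<kappa> * D t) - N t * (2 * \<kappa> * (\<omega> * N t / 2))) / (2 * \<kappa> * D t * (2 * \<kappa> * D t))) (at t)"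
      unfolding XY_def
      by (rule DERIV_divide DERIV_cmult N_deriv D_deriv)+ (use assms pos in simp)
    also have "(N' t * (2 * \<kappa> * D t) - N t * (2 * \<kappa> * (\<omega> * N t / 2))) / (2 * \<kappa> * D t * (2 * \<kappa> * D t)) =
        - ((1 - 1 / (D t)\<^sup>2) / (2 * \<kappa>) + 1 / 2 * \<kappa> * \<omega> * (X t)\<^sup>2)"
      unfolding N' XY_def using assms pos by (simp add: field_simps power2_eq_square)
    finally show ?thesis
      unfolding e .
  qed
  have XY_0: "X 0 = \<alpha>\<^sub>1" "Y 0 = \<alpha>\<^sub>2"
    using assms flow_D_0[of \<omega> \<kappa> \<alpha>\<^sub>1 \<alpha>\<^sub>2] by (simp_all add: XY_def ND_def flow_N_def)
  have D_nz: "?D z \<noteq> 0" "?D z \<notin> \<real>\<^sub>\<le>\<^sub>0" if "z \<in> ball 0 r" for z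
    using r(2)[of z] that by (auto simp: complex_nonpos_Reals_iff)
  show "flow_series \<kappa> \<omega> (\<alpha>\<^sub>1, \<alpha>\<^sub>2) P1_fun = fps_expansion (\<lambda>\<phi>. ?N \<phi> / (2 * of_real \<kappa> * ?D \<phi>)) 0"
  proof (subst fps_expansion_along_curve[OF L_P1 r(1) _ _ X Y])
    show "(\<lambda>\<phi>. ?N \<phi> / (2 * of_real \<kappa> * ?D \<phi>)) holomorphic_on ball 0 r"
      using assms D_nz by (intro holomorphic_intros hol) auto
  qed (simp_all add: of_real P1_fun_def XY_0, simp add: XY_def)
  show "flow_series \<kappa> \<omega> (\<alpha>\<^sub>1, \<alpha>\<^sub>2) P2_fun = fps_expansion (\<lambda>\<phi>. 1 / of_real \<kappa> * Ln (?D \<phi>)) 0"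
  proof (subst fps_expansion_along_curve[OF L_P2 r(1) _ _ X Y])
    show "(\<lambda>\<phi>. 1 / of_real \<kappa> * Ln (?D \<phi>)) holomorphic_on ball 0 r"
      using assms D_nz by (intro holomorphic_intros hol) auto
  qed (simp_all add: of_real P2_fun_def XY_0, simp add: XY_def Ln_of_real D_pos)
qed

theorem mainTheorem1:
  fixes \<omega> \<kappa> \<alpha>\<^sub>1 \<alpha>\<^sub>2 :: real
  assumes "\<kappa> \<noteq> 0"
  shows
    "bij_betw (to_fps \<kappa> \<omega>) (C_up \<kappa> \<omega> \<alpha>\<^sub>1 \<alpha>\<^sub>2) UNIV
     \<and> (\<forall>f\<in>C_up \<kappa> \<omega> \<alpha>\<^sub>1 \<alpha>\<^sub>2. \<forall>g\<in>C_up \<kappa> \<omega> \<alpha>\<^sub>1 \<alpha>\<^sub>2.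
          to_fps \<kappa> \<omega> (\<lambda>h\<in>carrier (U_alg \<kappa> \<omega>). f h + g h) = to_fps \<kappa> \<omega> f + to_fps \<kappa> \<omega> g)
     \<and> (\<forall>c. \<forall>f\<in>C_up \<kappa> \<omega> \<alpha>\<^sub>1 \<alpha>\<^sub>2.
          to_fps \<kappa> \<omega> (\<lambda>h\<in>carrier (U_alg \<kappa> \<omega>). c * f h) = fps_const c * to_fps \<kappa> \<omega> f)
     \<and> (\<forall>f\<in>C_up \<kappa> \<omega> \<alpha>\<^sub>1 \<alpha>\<^sub>2.
          to_fps \<kappa> \<omega> (U_act \<kappa> \<omega> f (U_J \<kappa> \<omega>)) = fps_deriv (to_fps \<kappa> \<omega> f)
        \<and> to_fps \<kappa> \<omega> (U_act \<kappa> \<omega> f (U_L \<kappa> \<omega> P1_fun)) = to_fps \<kappa> \<omega> f *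
            fps_expansion (\<lambda>\<phi>.
              (of_real (2 * \<kappa> * \<alpha>\<^sub>1 * exp (\<kappa> * \<alpha>\<^sub>2)) * C_fun \<omega> \<phi>
               + of_real (\<omega> * \<kappa>\<^sup>2 * \<alpha>\<^sub>1\<^sup>2 * exp (\<kappa> * \<alpha>\<^sub>2) - 2 * sinh (\<kappa> * \<alpha>\<^sub>2)) * S_fun \<omega> \<phi>)
              / (of_real (2 * \<kappa> * cosh (\<kappa> * \<alpha>\<^sub>2) + \<omega> * \<kappa>^3 * \<alpha>\<^sub>1\<^sup>2 * exp (\<kappa> * \<alpha>\<^sub>2))
                 + of_real (2 * \<kappa> * sinh (\<kappa> * \<alpha>\<^sub>2) - \<omega> * \<kappa>^3 * \<alpha>\<^sub>1\<^sup>2 * exp (\<kappa> * \<alpha>\<^sub>2)) * C_fun \<omega> \<phi>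
                 + of_real (2 * \<omega> * \<kappa>\<^sup>2 * \<alpha>\<^sub>1 * exp (\<kappa> * \<alpha>\<^sub>2)) * S_fun \<omega> \<phi>)) 0
        \<and> to_fps \<kappa> \<omega> (U_act \<kappa> \<omega> f (U_L \<kappa> \<omega> P2_fun)) = to_fps \<kappa> \<omega> f *
            fps_expansion (\<lambda>\<phi>.
              1 / of_real \<kappa> *
              Ln (of_real (cosh (\<kappa> * \<alpha>\<^sub>2) + 1 / 2 * \<omega> * \<kappa>\<^sup>2 * \<alpha>\<^sub>1\<^sup>2 * exp (\<kappa> * \<alpha>\<^sub>2))
                  + of_real (sinh (\<kappa> * \<alpha>\<^sub>2) - 1 / 2 * \<omega> * \<kappa>\<^sup>2 * \<alpha>\<^sub>1\<^sup>2 * exp (\<kappa> * \<alpha>\<^sub>2)) * C_fun \<omega> \<phi>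
                  + of_real (\<omega> * \<kappa> * \<alpha>\<^sub>1 * exp (\<kappa> * \<alpha>\<^sub>2)) * S_fun \<omega> \<phi>)) 0)"
proof -
  \<comment> \<open>The denominator for P_1 is 2 \<kappa> times the argument of the logarithm for
    P_2.\<close>
  have D: "of_real (2 * \<kappa> * cosh (\<kappa> * \<alpha>\<^sub>2) + \<omega> * \<kappa>^3 * \<alpha>\<^sub>1\<^sup>2 * exp (\<kappa> * \<alpha>\<^sub>2))
      + of_real (2 * \<kappa> * sinh (\<kappa> * \<alpha>\<^sub>2) - \<omega> * \<kappa>^3 * \<alpha>\<^sub>1\<^sup>2 * exp (\<kappa> * \<alpha>\<^sub>2)) * C_fun \<omega> \<phi>
      + of_real (2 * \<omega> * \<kappa>\<^sup>2 * \<alpha>\<^sub>1 * exp (\<kappa> * \<alpha>\<^sub>2)) * S_fun \<omega> \<phi>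
      = 2 * of_real \<kappa> * flow_D \<omega> \<kappa> \<alpha>\<^sub>1 \<alpha>\<^sub>2 \<phi>" for \<phi>
    by (simp add: flow_D_def algebra_simps power2_eq_square power3_eq_cube)
  \<comment> \<open>Sums and multiples of functionals are restricted to the carrier, so they may be
    evaluated at J^n only once it is known to lie there.\<close>
  have pow: "U_J \<kappa> \<omega> [^]\<^bsub>U_alg \<kappa> \<omega>\<^esub> n \<in> carrier (U_alg \<kappa> \<omega>)" for n :: nat
  proof -
    interpret U: ring "U_alg \<kappa> \<omega>" by (rule ring_U_alg)
    show ?thesis by (rule U.nat_pow_closed[OF U_J_carrier])
  qed
  have bij: "bij_betw (to_fps \<kappa> \<omega>) (C_up \<kappa> \<omega> \<alpha>\<^sub>1 \<alpha>\<^sub>2) UNIV"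
  proof (rule bij_betw_imageI[OF to_fps_inj])
    show "to_fps \<kappa> \<omega> ` C_up \<kappa> \<omega> \<alpha>\<^sub>1 \<alpha>\<^sub>2 = UNIV"
      by (metis UNIV_eq_I image_eqI to_fps_surj)
  qed
  show ?thesis
    unfolding D flow_N_def[symmetric] flow_D_def[symmetric] flow_series_P1_P2[OF assms, symmetric]
  proof (intro conjI ballI allI bij)
    fix f g
    show "to_fps \<kappa> \<omega> (\<lambda>h\<in>carrier (U_alg \<kappa> \<omega>). f h + g h) = to_fps \<kappa> \<omega> f + to_fps \<kappa> \<omega> g"
      by (simp add: fps_eq_iff to_fps_def pow add_divide_distrib)
  next
    fix c f
    show "to_fps \<kappa> \<omega> (\<lambda>h\<in>carrier (U_alg \<kappa> \<omega>). c * f h) = fps_const c * to_fps \<kappa> \<omega> f"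
      by (simp add: fps_eq_iff to_fps_def pow)
  qed (rule to_fps_U_act_J to_fps_U_act_L L_alg.L_P1 L_alg.L_P2 | assumption)+
qed

end
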